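(* Let $p>1$, let $(X,\mu)$ be a non-atomic probability space equipped with a tree $\mathcal T$, and let $\mathcal M_{\mathcal T}$ be the associated maximal operator. Let $\phi:X\to[0,\infty)$ be $\mathcal T$-good with $\int_X\phi\,d\mu=f$, and let $q\in[1,p]$. Then for every $\beta>0$, $$\int_X(\mathcal M_{\mathcal T}\phi)^p\,d\mu\ \le\ -\frac{q(\beta+1)}{(p-1)q\beta+(p-q)}\,f^p+\frac{p(\beta+1)^q}{(p-1)q\beta+(p-q)}\int_X\phi^q(\mathcal M_{\mathcal T}\phi)^{p-q}\,d\mu .$$ Additionally, this inequality is best possible for any given $q\in[1,p]$, $f>0$ and $\beta$ with $0<\beta\le\frac1{p-1}$, in the sense that, with the second constant on the right-hand side fixed, the absolute value of the constant in front of $f^p$ cannot be increased: for every $c>\frac{q(\beta+1)}{(p-1)q\beta+(p-q)}$ there exists a $\mathcal T$-good $\phi:X\to[0,\infty)$ with $\int_X\phi\,d\mu=f$ for which the inequality $$\int_X(\mathcal M_{\mathcal T}\phi)^p\,d\mu\le -c\,f^p+\frac{p(\beta+1)^q}{(p-1)q\beta+(p-q)}\int_X\phi^q(\mathcal M_{\mathcal T}\phi)^{p-q}\,d\mu$$ fails.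
   Context: Tree: a set $\mathcal T$ of measurable subsets of $X$ is called a tree if (i) $X\in\mathcal T$ and $\mu(I)>0$ for every $I\in\mathcal T$; (ii) to every $I\in\mathcal T$ there corresponds a finite or countable subset $C(I)\subseteq\mathcal T$ containing at least two elements, such that the elements of $C(I)$ are pairwise disjoint subsets of $I$ and $I=\bigcup C(I)$; (iii) $\mathcal T=\bigcup_{m\ge0}\mathcal T_{(m)}$, where $\mathcal T_{(0)}=\{X\}$ and $\mathcal T_{(m+1)}=\bigcup_{I\in\mathcal T_{(m)}}C(I)$; (iv) $\lim_{m\to\infty}\sup_{I\in\mathcal T_{(m)}}\mu(I)=0$. Maximal operator: for $\phi\in L^1(X,\mu)$, $\mathcal M_{\mathcal T}\phi(x)=\sup\left\{\frac1{\mu(I)}\int_I|\phi|\,d\mu:\ x\in I\in\mathcal T\right\}$. $\mathcal T$-good: for nonnegative $\phi\in L^1(X,\mu)$ and $I\in\mathcal T$ put $\mathrm{Av}_I(\phi)=\frac1{\mu(I)}\int_I\phi\,d\mu$. The function $\phi$ is called $\mathcal T$-good if the set $\{x\in X:\ \mathcal M_{\mathcal T}\phi(x)>\mathrm{Av}_I(\phi)\text{ for all }I\in\mathcal T\text{ with }x\in I\}$ has $\mu$-measure zero. Integrals of nonnegative functions are taken in $[0,\infty]$. *)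

theory Defs
  imports "HOL-Probability.Probability"
begin

definition nonatomic :: "'a measure \<Rightarrow> bool" where
  "nonatomic M \<longleftrightarrow>
     (\<forall>A\<in>sets M. 0 < emeasure M A \<longrightarrow>
        (\<exists>B\<in>sets M. B \<subseteq> A \<and> 0 < emeasure M B \<and> emeasure M B < emeasure M A))"

primrec tree_level :: "'a set \<Rightarrow> ('a set \<Rightarrow> 'a set set) \<Rightarrow> nat \<Rightarrow> 'a set set" where
  "tree_level X C 0 = {X}"
| "tree_level X C (Suc m) = (\<Union>I\<in>tree_level X C m. C I)"

definition is_tree :: "'a measure \<Rightarrow> 'a set set \<Rightarrow> bool" where
  "is_tree M T \<longleftrightarrow>
     T \<subseteq> sets M \<and> space M \<in> T \<and> (\<forall>I\<in>T. 0 < emeasure M I) \<and>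
     (\<exists>C. (\<forall>I\<in>T. C I \<subseteq> T \<and> countable (C I) \<and> (\<exists>J\<in>C I. \<exists>K\<in>C I. J \<noteq> K) \<and>
                   disjoint (C I) \<and> I = \<Union>(C I)) \<and>
          T = (\<Union>m. tree_level (space M) C m) \<and>
          (\<lambda>m. SUP I\<in>tree_level (space M) C m. emeasure M I) \<longlonglongrightarrow> 0)"

definition Av :: "'a measure \<Rightarrow> 'a set \<Rightarrow> ('a \<Rightarrow> real) \<Rightarrow> real" where
  "Av M I \<phi> = (LINT x:I|M. \<phi> x) / measure M I"

text \<open>The maximal function may be infinite at some points, hence the extended codomain.\<close>

definition tree_maximal :: "'a measure \<Rightarrow> 'a set set \<Rightarrow> ('a \<Rightarrow> real) \<Rightarrow> 'a \<Rightarrow> ennreal" where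
  "tree_maximal M T \<phi> x = (SUP I\<in>{I\<in>T. x \<in> I}. ennreal (Av M I (\<lambda>y. \<bar>\<phi> y\<bar>)))"

definition tree_good :: "'a measure \<Rightarrow> 'a set set \<Rightarrow> ('a \<Rightarrow> real) \<Rightarrow> bool" where
  "tree_good M T \<phi> \<longleftrightarrow>
     integrable M \<phi> \<and> (\<forall>x\<in>space M. 0 \<le> \<phi> x) \<and>
     {x\<in>space M. \<forall>I\<in>T. x \<in> I \<longrightarrow> ennreal (Av M I \<phi>) < tree_maximal M T \<phi> x} \<in> null_sets M"

text \<open>
  The power \<open>x\<^sup>a\<close> on \<open>[0, \<infinity>]\<close> for an exponent \<open>a \<ge> 0\<close>. The separate case \<open>a = 0\<close> is needed
  because \<^term>\<open>0 powr 0 = (0::real)\<close>, whereas here \<open>0\<^sup>0 = \<infinity>\<^sup>0 = 1\<close>.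
\<close>

definition ennreal_powr :: "ennreal \<Rightarrow> real \<Rightarrow> ennreal" where
  "ennreal_powr x a =
     (if a = 0 then 1 else if x = \<infinity> then \<infinity> else ennreal (enn2real x powr a))"

end

theory Submission
  imports Defs
begin

text \<open>
  Upper bound: the maximal tree sets of average above \<open>t\<close> give \<open>t \<mu>(\<M>\<phi> > t) \<le> \<integral>\<^bsub>\<M>\<phi> > t\<^esub> \<phi>\<close>,
  and integrating over \<open>t \<ge> f\<close> gives
  \<open>(p - 1) \<integral>(\<M>\<phi>)\<^sup>p \<le> - f\<^sup>p + p \<integral>\<phi> (\<M>\<phi>)\<^bsup>p-1\<^esup>\<close>. Young's inequality splits
  \<open>\<phi> (\<M>\<phi>)\<^bsup>p-1\<^esup>\<close> into \<open>\<phi>\<^sup>q (\<M>\<phi>)\<^bsup>p-q\<^esup>\<close> and \<open>(\<M>\<phi>)\<^sup>p\<close>, with equality for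
  \<open>\<phi> = \<M>\<phi> / (\<beta> + 1)\<close>.

  Sharpness: on a tree set with average \<open>y\<close> put \<open>\<phi> = b y\<close>, with \<open>b\<close> slightly above
  \<open>1 / (\<beta> + 1)\<close>, on a part of small relative measure \<open>s\<close> whose complement is a finite union of
  tree sets of one level. Repeat inside those, whose averages are then
  \<open>r y\<close> with \<open>r = (1 - b s) / (1 - s)\<close>, and stop after finitely many rounds. No average of \<open>\<phi>\<close>
  over a tree set meeting the part exceeds \<open>r y\<close>, so there \<open>y \<le> \<M>\<phi> \<le> r y\<close>, and \<open>r\<close> tends
  to \<open>1\<close> with \<open>s\<close>.
\<close>

section \<open>Trees of sets\<close>

text \<open>Adding the sets one at a time, stop as soon as the measure reaches \<open>u\<close>; the
  last set overshoots by at most \<open>e\<close>.\<close>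

lemma measure_finite_Union_le_ex:
  fixes M :: "'a measure" and D :: "'a set set"
  assumes "finite_measure M" and D: "countable D" "D \<subseteq> sets M"
    and small: "\<And>J. J \<in> D \<Longrightarrow> measure M J \<le> e"
    and u: "0 < u" "u < measure M (\<Union>D)"
  shows "\<exists>F. finite F \<and> F \<subseteq> D \<and> u \<le> measure M (\<Union>F) \<and> measure M (\<Union>F) \<le> u + e"
proof -
  interpret finite_measure M by fact
  have "D \<noteq> {}" using u by auto
  \<comment> \<open>For finite \<open>D\<close> the enumeration repeats sets, which is harmless
    because only the unions \<open>U n\<close> enter.\<close>
  define d where "d = from_nat_into D"
  have rd: "range d = D" unfolding d_def by (rule range_from_nat_into) fact+
  define U where "U n = \<Union>(d ` {..<n})" for n :: nat
  have dD: "d n \<in> D" for n using rd by auto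
  have dm: "d n \<in> sets M" for n using dD D by auto
  have Um: "U n \<in> sets M" for n unfolding U_def using dm by (intro sets.finite_Union) auto
  have "incseq U" unfolding U_def by (intro monoI Union_mono image_mono) auto
  moreover have "(\<Union>n. U n) = \<Union>D"
    unfolding U_def rd[symmetric] by (auto intro: lessI)
  ultimately have "(\<lambda>n. measure M (U n)) \<longlonglongrightarrow> measure M (\<Union>D)"
    using finite_Lim_measure_incseq[of U] Um by auto
  then have "eventually (\<lambda>n. u < measure M (U n)) sequentially"
    using u(2) by (rule order_tendstoD)
  then have ex: "\<exists>n. u \<le> measure M (U n)"
    by (auto simp: eventually_sequentially intro: less_imp_le)
  define n where "n = (LEAST n. u \<le> measure M (U n))"
  have n: "u \<le> measure M (U n)" unfolding n_def by (rule LeastI_ex[OF ex])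
  have "n \<noteq> 0"
  proof
    assume "n = 0"
    then show False using n u(1) by (simp add: U_def)
  qed
  then obtain m where m: "n = Suc m" by (cases n) auto
  have "\<not> u \<le> measure M (U m)" using not_less_Least[of m "\<lambda>n. u \<le> measure M (U n)"] m
    by (simp add: n_def)
  moreover have Un: "U n = U m \<union> d m" unfolding U_def m by (auto simp: lessThan_Suc)
  moreover have "measure M (U n) \<le> measure M (U m) + measure M (d m)"
    unfolding Un by (rule measure_Un_le) (use Um dm in auto)
  ultimately have "measure M (U n) \<le> u + e" using small[OF dD[of m]] by linarith
  with n show ?thesis unfolding U_def using dD by (intro exI[of _ "d ` {..<n}"]) auto
qed

text \<open>Fixes one of the child maps \<open>C\<close> that \<open>is_tree\<close> only asserts to
  exist, so that the levels can be named.\<close>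

locale measure_tree = prob_space M for M :: "'a measure" +
  fixes T :: "'a set set" and C :: "'a set \<Rightarrow> 'a set set"
  assumes T_sets: "T \<subseteq> sets M"
    and T_pos: "I \<in> T \<Longrightarrow> 0 < emeasure M I"
    and C_countable: "I \<in> T \<Longrightarrow> countable (C I)"
    and C_disjoint: "I \<in> T \<Longrightarrow> disjoint (C I)"
    and C_Union: "I \<in> T \<Longrightarrow> I = \<Union>(C I)"
    and T_levels: "T = (\<Union>m. tree_level (space M) C m)"
    and levels_vanish: "(\<lambda>m. SUP I\<in>tree_level (space M) C m. emeasure M I) \<longlonglongrightarrow> 0"
begin

abbreviation level :: "nat \<Rightarrow> 'a set set" where "level \<equiv> tree_level (space M) C"

lemma level_T: "I \<in> level m \<Longrightarrow> I \<in> T"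
  using T_levels by blast

lemma T_measurable [measurable_dest, simp]: "I \<in> T \<Longrightarrow> I \<in> sets M"
  using T_sets by blast

lemma T_space: "I \<in> T \<Longrightarrow> I \<subseteq> space M"
  by (meson T_measurable sets.sets_into_space)

lemma space_in_T: "space M \<in> T"
  by (rule level_T[of _ 0]) simp

lemma T_measure_pos: "I \<in> T \<Longrightarrow> 0 < measure M I"
  using T_pos[of I] by (simp add: emeasure_eq_measure)

lemma countable_level: "countable (level m)"
  by (induction m) (auto intro!: countable_UN C_countable dest: level_T)

lemma countable_T: "countable T"
  using countable_level by (subst T_levels) auto

text \<open>If two sets meet, so do their parents; by induction the parents agree, and the sets are
  siblings.\<close>

lemma level_disjoint: "I \<in> level m \<Longrightarrow> J \<in> level m \<Longrightarrow> I \<inter> J \<noteq> {} \<Longrightarrow> I = J"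
proof (induction m arbitrary: I J)
  case (Suc m)
  then obtain I' J' where I': "I' \<in> level m" "I \<in> C I'" and J': "J' \<in> level m" "J \<in> C J'"
    by auto
  have "I \<subseteq> I'" "J \<subseteq> J'"
    using I' J' C_Union[OF level_T] by blast+
  then have "I' \<inter> J' \<noteq> {}" using Suc.prems by blast
  then have "I' = J'" using Suc.IH I' J' by blast
  then show ?case using C_disjoint[OF level_T[OF I'(1)]] I' J' Suc.prems(3)
    by (auto simp: disjoint_def)
qed auto

lemma level_cover: "x \<in> space M \<Longrightarrow> \<exists>I\<in>level m. x \<in> I"
proof (induction m)
  case (Suc m)
  then obtain I where I: "I \<in> level m" "x \<in> I" by blast
  then obtain J where "J \<in> C I" "x \<in> J" using C_Union[OF level_T] by blast
  then show ?case using I by auto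
qed auto

lemma level_ancestor: "I \<in> level (m + k) \<Longrightarrow> \<exists>J\<in>level m. I \<subseteq> J"
proof (induction k arbitrary: I)
  case (Suc k)
  then obtain I' where I': "I' \<in> level (m + k)" "I \<in> C I'" by auto
  then have "I \<subseteq> I'" using C_Union[OF level_T] by blast
  then show ?case using Suc.IH[OF I'(1)] by blast
qed auto

text \<open>The ancestor of \<open>J\<close> on level \<open>m\<close> meets \<open>I\<close> and
  therefore is \<open>I\<close>.\<close>

lemma level_nested:
  assumes "I \<in> level m" "J \<in> level n" "m \<le> n" "I \<inter> J \<noteq> {}"
  shows "J \<subseteq> I"
proof -
  obtain K where K: "K \<in> level m" "J \<subseteq> K"
    using level_ancestor[of J m "n - m"] assms by auto
  then have "K = I" using level_disjoint assms by blast
  then show ?thesis using K by simp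
qed

lemma T_nested: "I \<in> T \<Longrightarrow> J \<in> T \<Longrightarrow> I \<subseteq> J \<or> J \<subseteq> I \<or> I \<inter> J = {}"
  by (metis Int_commute T_levels UN_E level_nested linorder_le_cases)

lemma level_small:
  assumes "0 < e"
  obtains n where "\<And>m J. n \<le> m \<Longrightarrow> J \<in> level m \<Longrightarrow> measure M J \<le> e"
proof -
  have "eventually (\<lambda>m. (SUP I\<in>level m. emeasure M I) < ennreal e) sequentially"
    using levels_vanish assms by (intro order_tendstoD(2)[where y = 0]) auto
  then obtain n where n: "\<And>m. n \<le> m \<Longrightarrow> (SUP I\<in>level m. emeasure M I) < ennreal e"
    by (auto simp: eventually_sequentially)
  have "measure M J \<le> e" if "n \<le> m" "J \<in> level m" for m J
  proof -
    have "emeasure M J \<le> (SUP I\<in>level m. emeasure M I)" using that by (intro SUP_upper)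
    also have "\<dots> < ennreal e" using n that by blast
    finally show ?thesis using assms by (simp add: emeasure_eq_measure ennreal_less_iff)
  qed
  then show ?thesis using that by blast
qed

text \<open>Supplies what remains of \<open>I\<close> after removing a part of relative measure
  between \<open>s / 2\<close> and \<open>s\<close>. Deep enough in the tree no set exceeds the
  width of this window, so some finite union lands in it.\<close>

lemma finite_subfamily:
  assumes "I \<in> T" "0 < s" "s < 1"
  obtains k F where "finite F" "F \<subseteq> level k" "\<Union>F \<subseteq> I"
    "\<And>J. J \<in> level k \<Longrightarrow> J \<inter> I \<noteq> {} \<Longrightarrow> J \<subseteq> I"
    "(1 - s) * measure M I \<le> measure M (\<Union>F)" "measure M (\<Union>F) \<le> (1 - s / 2) * measure M I"
proof -
  note Ipos = T_measure_pos[OF assms(1)]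
  obtain l where l: "I \<in> level l" using assms(1) T_levels by blast
  define e where "e = s / 2 * measure M I"
  have "0 < e" using Ipos assms by (simp add: e_def)
  then obtain n where n: "\<And>m J. n \<le> m \<Longrightarrow> J \<in> level m \<Longrightarrow> measure M J \<le> e"
    using level_small by blast
  \<comment> \<open>\<open>k \<ge> l\<close> puts every level-\<open>k\<close> set that meets
    \<open>I\<close> inside \<open>I\<close>; \<open>k \<ge> n\<close> makes these sets
    small.\<close>
  define k where "k = max l n"
  have sub: "J \<subseteq> I" if "J \<in> level k" "J \<inter> I \<noteq> {}" for J
    using level_nested[OF l that(1)] that(2) by (auto simp: k_def)
  define D where "D = {J \<in> level k. J \<subseteq> I}"
  have UD: "\<Union>D = I"
  proof
    show "I \<subseteq> \<Union>D"
    proof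
      fix x assume x: "x \<in> I"
      then obtain J where "J \<in> level k" "x \<in> J"
        using level_cover[of x k] T_space[OF assms(1)] by blast
      then show "x \<in> \<Union>D" using sub[of J] x by (auto simp: D_def)
    qed
  qed (auto simp: D_def)
  have "\<exists>F. finite F \<and> F \<subseteq> D \<and> (1 - s) * measure M I \<le> measure M (\<Union>F)
      \<and> measure M (\<Union>F) \<le> (1 - s) * measure M I + e"
  proof (rule measure_finite_Union_le_ex)
    show "countable D" unfolding D_def using countable_level[of k] by (rule countable_subset[rotated]) auto
    show "D \<subseteq> sets M" unfolding D_def using level_T by auto
    show "measure M J \<le> e" if "J \<in> D" for J using n[of k J] that by (auto simp: D_def k_def)
    show "(1 - s) * measure M I < measure M (\<Union>D)" "0 < (1 - s) * measure M I"
      using Ipos assms by (auto simp: UD)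
  qed (rule finite_measure_axioms)
  then obtain F where F: "finite F" "F \<subseteq> D" "(1 - s) * measure M I \<le> measure M (\<Union>F)"
      "measure M (\<Union>F) \<le> (1 - s) * measure M I + e" by blast
  show ?thesis
  proof (rule that[of F k])
    show "measure M (\<Union>F) \<le> (1 - s / 2) * measure M I"
      using F(4) by (simp add: e_def algebra_simps)
  qed (use F sub in \<open>auto simp: D_def\<close>)
qed

section \<open>Averages, pointwise bounds for the maximal function, and goodness\<close>

lemma Av_const:
  assumes "I \<in> T" "\<And>z. z \<in> I \<Longrightarrow> \<phi> z = c"
  shows "Av M I \<phi> = c"
proof -
  have "(LINT x:I|M. \<phi> x) = (LINT x:I|M. c)"
    by (rule set_lebesgue_integral_cong) (use assms in auto)
  also have "\<dots> = measure M I * c"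
    using assms(1) by (simp add: set_lebesgue_integral_def)
  finally show ?thesis using T_measure_pos[OF assms(1)] by (simp add: Av_def)
qed

lemma Av_cong: "I \<in> T \<Longrightarrow> (\<And>z. z \<in> I \<Longrightarrow> \<phi> z = \<psi> z) \<Longrightarrow> Av M I \<phi> = Av M I \<psi>"
  unfolding Av_def by (subst set_lebesgue_integral_cong[of I M \<phi> \<psi>]) auto

lemma Av_abs: "I \<in> T \<Longrightarrow> (\<And>x. x \<in> space M \<Longrightarrow> 0 \<le> \<phi> x) \<Longrightarrow> Av M I (\<lambda>x. \<bar>\<phi> x\<bar>) = Av M I \<phi>"
  by (intro Av_cong) (meson T_space abs_of_nonneg subsetD)+

lemma Av_le_tree_maximal:
  assumes "I \<in> T" "x \<in> I" "\<And>x. x \<in> space M \<Longrightarrow> 0 \<le> \<phi> x"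
  shows "ennreal (Av M I \<phi>) \<le> tree_maximal M T \<phi> x"
  unfolding tree_maximal_def using assms
  by (subst Av_abs[OF assms(1,3), symmetric]) (auto intro: SUP_upper)

lemma tree_maximal_least:
  assumes "\<And>I. I \<in> T \<Longrightarrow> x \<in> I \<Longrightarrow> ennreal (Av M I \<phi>) \<le> z" "\<And>x. x \<in> space M \<Longrightarrow> 0 \<le> \<phi> x"
  shows "tree_maximal M T \<phi> x \<le> z"
  unfolding tree_maximal_def using assms by (auto intro!: SUP_least simp: Av_abs)

text \<open>Below a set on which \<open>\<phi>\<close> is constant no new averages occur, and only finitely many
  tree sets lie above it.\<close>

lemma tree_good_if_locally_constant:
  assumes \<phi>: "integrable M \<phi>" "\<And>x. x \<in> space M \<Longrightarrow> 0 \<le> \<phi> x"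
    and const: "\<And>x. x \<in> space M \<Longrightarrow> \<exists>J\<in>T. x \<in> J \<and> (\<forall>z\<in>J. \<phi> z = \<phi> x)"
  shows "tree_good M T \<phi>"
proof -
  have attained: "\<exists>I\<in>T. x \<in> I \<and> tree_maximal M T \<phi> x \<le> ennreal (Av M I \<phi>)"
    if x: "x \<in> space M" for x
  proof -
    obtain J where J: "J \<in> T" "x \<in> J" "\<And>z. z \<in> J \<Longrightarrow> \<phi> z = \<phi> x" using const[OF x] by blast
    obtain n where n: "J \<in> level n" using J(1) T_levels by blast
    \<comment> \<open>\<open>J\<close> stands for all tree sets inside it, whose averages all equal
      \<open>\<phi> x\<close>. If the remaining candidates are finitely many, the supremum is
      attained.\<close>
    define S where "S = insert J {I \<in> T. x \<in> I \<and> \<not> I \<subseteq> J}"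
    have "{I \<in> T. x \<in> I \<and> \<not> I \<subseteq> J} \<subseteq> (\<Union>m\<in>{..n}. {I \<in> level m. x \<in> I})"
    proof
      fix I assume I: "I \<in> {I \<in> T. x \<in> I \<and> \<not> I \<subseteq> J}"
      then obtain m where m: "I \<in> level m" using T_levels by blast
      \<comment> \<open>A tree set through \<open>x\<close> that is not inside \<open>J\<close> lies
        on one of the finitely many levels above that of \<open>J\<close>.\<close>
      have "\<not> n \<le> m" using level_nested[OF n m] I J(2) by blast
      then show "I \<in> (\<Union>m\<in>{..n}. {I \<in> level m. x \<in> I})" using m I by auto
    qed
    moreover have "finite {I \<in> level m. x \<in> I}" for m
    proof -
      \<comment> \<open>Two sets of one level that share \<open>x\<close> coincide.\<close>
      obtain K where "{I \<in> level m. x \<in> I} \<subseteq> {K}"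
        using level_disjoint[of _ m] by (cases "{I \<in> level m. x \<in> I} = {}") blast+
      then show ?thesis by (rule finite_subset) simp
    qed
    ultimately have "finite {I \<in> T. x \<in> I \<and> \<not> I \<subseteq> J}"
      by (meson finite_UN_I finite_atMost finite_subset)
    then have "finite S" by (simp add: S_def)
    then have fin: "finite ((\<lambda>I. Av M I \<phi>) ` S)" by (rule finite_imageI)
    have "Max ((\<lambda>I. Av M I \<phi>) ` S) \<in> (\<lambda>I. Av M I \<phi>) ` S"
      by (rule Max_in[OF fin]) (simp add: S_def)
    then obtain I where I: "I \<in> S" "Max ((\<lambda>I. Av M I \<phi>) ` S) = Av M I \<phi>" by blast
    have max: "Av M K \<phi> \<le> Av M I \<phi>" if "K \<in> S" for K
      unfolding I(2)[symmetric] by (rule Max_ge[OF fin imageI[OF that]])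
    have "tree_maximal M T \<phi> x \<le> ennreal (Av M I \<phi>)"
    proof (rule tree_maximal_least)
      fix K assume K: "K \<in> T" "x \<in> K"
      have "Av M K \<phi> \<le> Av M I \<phi>"
      proof (cases "K \<subseteq> J")
        case True
        have "Av M K \<phi> = \<phi> x" by (rule Av_const[OF K(1)]) (meson J(3) True subsetD)
        also have "\<dots> = Av M J \<phi>" by (rule Av_const[OF J(1,3), symmetric])
        also have "\<dots> \<le> Av M I \<phi>" by (rule max) (simp add: S_def)
        finally show ?thesis .
      next
        case False
        then show ?thesis using K by (intro max) (simp add: S_def)
      qed
      then show "ennreal (Av M K \<phi>) \<le> ennreal (Av M I \<phi>)" by (rule ennreal_leI)
    qed (rule \<phi>)
    then show ?thesis using I(1) J(1,2) by (auto simp: S_def)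
  qed
  have "{x \<in> space M. \<forall>I\<in>T. x \<in> I \<longrightarrow> ennreal (Av M I \<phi>) < tree_maximal M T \<phi> x} = {}"
    using attained by (auto simp: not_less[symmetric])
  then have "{x \<in> space M. \<forall>I\<in>T. x \<in> I \<longrightarrow> ennreal (Av M I \<phi>) < tree_maximal M T \<phi> x} \<in> null_sets M"
    by (simp only: null_sets.empty_sets)
  then show ?thesis using \<phi> unfolding tree_good_def by blast
qed

end

section \<open>The upper bound\<close>

context measure_tree begin

text \<open>The index set of the supremum depends on \<open>x\<close>; with indicators it becomes a
  supremum over the fixed countable \<open>T\<close>, since the extra terms are \<open>0\<close>,
  the least value.\<close>

lemma tree_maximal_measurable:
  assumes "\<And>x. x \<in> space M \<Longrightarrow> 0 \<le> \<phi> x"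
  shows "tree_maximal M T \<phi> \<in> borel_measurable M"
proof -
  have "tree_maximal M T \<phi> x = (SUP I\<in>T. ennreal (Av M I (\<lambda>y. \<bar>\<phi> y\<bar>)) * indicator I x)" for x
    unfolding tree_maximal_def
  proof (rule antisym)
    show "(SUP I\<in>{I \<in> T. x \<in> I}. ennreal (Av M I (\<lambda>y. \<bar>\<phi> y\<bar>)))
      \<le> (SUP I\<in>T. ennreal (Av M I (\<lambda>y. \<bar>\<phi> y\<bar>)) * indicator I x)"
      by (rule SUP_mono) force
    show "(SUP I\<in>T. ennreal (Av M I (\<lambda>y. \<bar>\<phi> y\<bar>)) * indicator I x)
      \<le> (SUP I\<in>{I \<in> T. x \<in> I}. ennreal (Av M I (\<lambda>y. \<bar>\<phi> y\<bar>)))"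
    proof (rule SUP_least)
      fix I assume "I \<in> T"
      then show "ennreal (Av M I (\<lambda>y. \<bar>\<phi> y\<bar>)) * indicator I x
        \<le> (SUP I\<in>{I \<in> T. x \<in> I}. ennreal (Av M I (\<lambda>y. \<bar>\<phi> y\<bar>)))"
        by (cases "x \<in> I") (auto intro: SUP_upper)
    qed
  qed
  moreover have "(\<lambda>x. SUP I\<in>T. ennreal (Av M I (\<lambda>y. \<bar>\<phi> y\<bar>)) * indicator I x) \<in> borel_measurable M"
    using countable_T by (intro borel_measurable_SUP) auto
  ultimately show ?thesis by presburger
qed

lemma nn_integral_tree_set:
  assumes "integrable M \<phi>" "\<And>x. x \<in> space M \<Longrightarrow> 0 \<le> \<phi> x" "I \<in> T"
  shows "(\<integral>\<^sup>+x. ennreal (\<phi> x) * indicator I x \<partial>M) = ennreal (Av M I \<phi> * measure M I)"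
proof -
  have "(\<integral>\<^sup>+x. ennreal (\<phi> x) * indicator I x \<partial>M) = (\<integral>\<^sup>+x. ennreal (indicator I x *\<^sub>R \<phi> x) \<partial>M)"
    by (intro nn_integral_cong) (auto split: split_indicator)
  also have "\<dots> = ennreal (LINT x:I|M. \<phi> x)"
    unfolding set_lebesgue_integral_def
    using assms by (intro nn_integral_eq_integral integrable_mult_indicator) auto
  finally show ?thesis using T_measure_pos[OF assms(3)] by (simp add: Av_def)
qed

text \<open>The level set is the disjoint union of the maximal tree sets with average above \<open>t\<close>.\<close>

lemma tree_maximal_weak_type:
  assumes \<phi>: "integrable M \<phi>" "\<And>x. x \<in> space M \<Longrightarrow> 0 \<le> \<phi> x" and t: "0 \<le> t"
  defines "E \<equiv> {x \<in> space M. ennreal t < tree_maximal M T \<phi> x}"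
  shows "ennreal t * emeasure M E \<le> (\<integral>\<^sup>+x. ennreal (\<phi> x) * indicator E x \<partial>M)"
proof -
  have [measurable]: "(\<lambda>x. ennreal (\<phi> x)) \<in> borel_measurable M" using \<phi> by simp
  define P where "P I \<longleftrightarrow> t < Av M I \<phi>" for I
  define S where "S = {I \<in> T. P I \<and> (\<forall>J\<in>T. P J \<longrightarrow> I \<subseteq> J \<longrightarrow> I = J)}"
  have ST: "S \<subseteq> T" by (auto simp: S_def)
  have disj: "disjoint_family_on (\<lambda>I. I) S"
    unfolding disjoint_family_on_def
  proof (intro ballI impI)
    fix I J assume "I \<in> S" "J \<in> S" "I \<noteq> J"
    then show "I \<inter> J = {}" using T_nested[of I J] unfolding S_def by blast
  qed
  have maximal: "\<exists>J\<in>S. I \<subseteq> J" if I: "I \<in> T" "P I" for I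
  proof -
    have ex: "\<exists>m. \<exists>J\<in>level m. I \<subseteq> J \<and> P J" using I T_levels by blast
    \<comment> \<open>Levels are well-ordered, so among the tree sets above \<open>I\<close> that
      satisfy \<open>P\<close> one on the lowest-numbered level is maximal.\<close>
    define m where "m = (LEAST m. \<exists>J\<in>level m. I \<subseteq> J \<and> P J)"
    obtain J where J: "J \<in> level m" "I \<subseteq> J" "P J"
      using LeastI_ex[OF ex] by (auto simp: m_def)
    have "J = K" if K: "K \<in> T" "P K" "J \<subseteq> K" for K
    proof -
      obtain k where k: "K \<in> level k" using K T_levels by blast
      have "\<exists>J\<in>level k. I \<subseteq> J \<and> P J" using k K J(2) by blast
      then have "m \<le> k" unfolding m_def by (rule Least_le)
      moreover have "J \<noteq> {}" using T_measure_pos[OF level_T[OF J(1)]] by auto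
      ultimately have "K \<subseteq> J" using level_nested[OF J(1) k] K(3) by blast
      then show ?thesis using K by blast
    qed
    then have "J \<in> S" using J level_T[OF J(1)] unfolding S_def by blast
    then show ?thesis using J by blast
  qed
  have above: "ennreal t < tree_maximal M T \<phi> x \<longleftrightarrow> (\<exists>I\<in>T. x \<in> I \<and> P I)" for x
    unfolding tree_maximal_def less_SUP_iff P_def using t by (auto simp: Av_abs \<phi> ennreal_less_iff)
  have E: "E = (\<Union>I\<in>S. I)"
  proof (intro equalityI subsetI)
    fix x assume "x \<in> E"
    then obtain I where "I \<in> T" "x \<in> I" "P I" unfolding E_def using above[of x] by blast
    then show "x \<in> (\<Union>I\<in>S. I)" using maximal[of I] by blast
  next
    fix x assume "x \<in> (\<Union>I\<in>S. I)"
    then obtain I where "I \<in> S" "x \<in> I" by blast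
    then have "I \<in> T" "P I" "x \<in> I" unfolding S_def by blast+
    then show "x \<in> E" unfolding E_def using above[of x] T_space[of I] by blast
  qed
  have cS: "countable S" using countable_T ST by (rule countable_subset[rotated])
  have mS: "I \<in> sets M" if "I \<in> S" for I using that ST by auto
  have "ennreal t * emeasure M E = (\<integral>\<^sup>+I. ennreal t * emeasure M I \<partial>count_space S)"
    unfolding E by (subst emeasure_UN_countable) (auto simp: cS mS disj nn_integral_cmult)
  \<comment> \<open>Writing the integrals of \<open>\<phi>\<close> as values of the measure with
    density \<open>\<phi>\<close> lets countable additivity sum them over \<open>S\<close>.\<close>
  also have "\<dots> \<le> (\<integral>\<^sup>+I. emeasure (density M (\<lambda>x. ennreal (\<phi> x))) I \<partial>count_space S)"
  proof (rule nn_integral_mono)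
    fix I assume "I \<in> space (count_space S)"
    then have I: "I \<in> T" "P I" by (auto simp: S_def)
    have "ennreal t * emeasure M I = ennreal (t * measure M I)"
      using t by (simp add: emeasure_eq_measure ennreal_mult)
    also have "\<dots> \<le> ennreal (Av M I \<phi> * measure M I)"
      using I(2) by (intro ennreal_leI mult_right_mono) (auto simp: P_def)
    also have "\<dots> = emeasure (density M (\<lambda>x. ennreal (\<phi> x))) I"
      using nn_integral_tree_set[OF \<phi> I(1)] I by (subst emeasure_density) auto
    finally show "ennreal t * emeasure M I \<le> emeasure (density M (\<lambda>x. ennreal (\<phi> x))) I" .
  qed
  also have "\<dots> = emeasure (density M (\<lambda>x. ennreal (\<phi> x))) E"
    unfolding E by (subst emeasure_UN_countable) (auto simp: cS mS disj)
  also have "\<dots> = (\<integral>\<^sup>+x. ennreal (\<phi> x) * indicator E x \<partial>M)"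
    unfolding E using cS mS by (subst emeasure_density) auto
  finally show ?thesis .
qed

end

section \<open>Layer-cake integration of the truncated maximal function\<close>

text \<open>With \<open>t = g x\<close> the half-open interval turns the condition on
  \<open>l\<close> into \<open>f \<le> l\<close> and \<open>l < g x\<close>, so the level sets are
  those of the strict inequality in the weak-type bound.\<close>

lemma nn_integral_powr_deriv:
  fixes a :: real
  assumes "0 < f" "f \<le> t" "0 < a"
  shows "(\<integral>\<^sup>+l. ennreal (a * l powr (a - 1)) * indicator {f..<t} l \<partial>lborel)
    = ennreal (t powr a - f powr a)"
proof -
  have "((\<lambda>l. a * l powr (a - 1)) has_integral (t powr a - f powr a)) {f..t}"
    using assms
    by (intro fundamental_theorem_of_calculus)
       (auto intro!: derivative_eq_intros simp: has_real_derivative_iff_has_vector_derivative[symmetric])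
  then have "((\<lambda>l. a * l powr (a - 1)) has_integral (t powr a - f powr a)) {f..<t}"
    by (rule has_integral_spike_set_eq[THEN iffD1, rotated 2]) (auto intro: negligible_subset[of "{t}"])
  from nn_integral_has_integral_lebesgue[OF _ this]
  have "(\<integral>\<^sup>+l. ennreal (indicator {f..<t} l * (a * l powr (a - 1))) \<partial>lborel) = ennreal (t powr a - f powr a)"
    using assms by auto
  then show ?thesis
    by (subst (asm) nn_integral_cong[where v = "\<lambda>l. ennreal (a * l powr (a - 1)) * indicator {f..<t} l"])
       (auto split: split_indicator)
qed

context measure_tree begin

text \<open>Layer-cake representation of both sides; the truncation at \<open>n\<close> keeps everything finite.\<close>

lemma truncated_maximal_ineq:
  fixes p n :: real
  assumes \<phi>: "integrable M \<phi>" "\<And>x. x \<in> space M \<Longrightarrow> 0 \<le> \<phi> x"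
    and f: "(LINT x|M. \<phi> x) = f" "0 < f" and p: "1 < p" and n: "f \<le> n"
  defines "g \<equiv> \<lambda>x. enn2real (min (tree_maximal M T \<phi> x) (ennreal n))"
  shows "\<And>x. x \<in> space M \<Longrightarrow> f \<le> g x" "\<And>x. x \<in> space M \<Longrightarrow> g x \<le> n"
    "g \<in> borel_measurable M"
    "(p - 1) * (LINT x|M. g x powr p) \<le> - (f powr p) + p * (LINT x|M. \<phi> x * g x powr (p - 1))"
proof -
  \<comment> \<open>The truncated value is finite, so \<open>enn2real\<close> loses nothing.\<close>
  have gE: "ennreal (g x) = min (tree_maximal M T \<phi> x) (ennreal n)" for x
    unfolding g_def by (rule ennreal_enn2real) (simp add: min_less_iff_disj)
  have g_meas [measurable]: "g \<in> borel_measurable M"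
    unfolding g_def using tree_maximal_measurable[of \<phi>] \<phi> by measurable
  have [measurable]: "\<phi> \<in> borel_measurable M" using \<phi> by simp
  have g0: "0 \<le> g x" for x by (simp add: g_def)
  \<comment> \<open>The whole space is a tree set, and its average is \<open>f\<close>.\<close>
  have gf: "f \<le> g x" if x: "x \<in> space M" for x
  proof -
    have "Av M (space M) \<phi> = f" using f by (simp add: Av_def set_integral_space \<phi> prob_space)
    then have "ennreal f \<le> tree_maximal M T \<phi> x"
      using Av_le_tree_maximal[where \<phi> = \<phi>, OF space_in_T x \<phi>(2)] by simp
    then have "ennreal f \<le> ennreal (g x)" using n unfolding gE by (intro min.boundedI ennreal_leI)
    then show ?thesis using ennreal_le_iff[OF g0[of x]] by blast
  qed
  have gn: "g x \<le> n" for x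
  proof -
    have "ennreal (g x) \<le> ennreal n" unfolding gE by (rule min.cobounded2)
    then show ?thesis using n f ennreal_le_iff[of n "g x"] by linarith
  qed
  show "\<And>x. x \<in> space M \<Longrightarrow> f \<le> g x" "\<And>x. x \<in> space M \<Longrightarrow> g x \<le> n" "g \<in> borel_measurable M"
    using gf gn g_meas by auto
  have weak: "ennreal l * emeasure M {x \<in> space M. l < g x}
      \<le> (\<integral>\<^sup>+x. ennreal (\<phi> x) * indicator {x \<in> space M. l < g x} x \<partial>M)" if l: "0 \<le> l" for l
  proof (cases "l < n")
    case True
    \<comment> \<open>Below the truncation height the level sets of \<open>g\<close> and of the
      maximal function coincide.\<close>
    have "l < g x \<longleftrightarrow> ennreal l < tree_maximal M T \<phi> x" for x
    proof -
      have "l < g x \<longleftrightarrow> ennreal l < ennreal (g x)" using l by (simp add: ennreal_less_iff)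
      also have "\<dots> \<longleftrightarrow> ennreal l < tree_maximal M T \<phi> x" using True l by (simp add: gE ennreal_less_iff)
      finally show ?thesis .
    qed
    then show ?thesis using tree_maximal_weak_type[OF \<phi> l] by simp
  next
    case False
    then have "\<not> l < g x" for x using gn[of x] by linarith
    then have empty: "{x \<in> space M. l < g x} = {}" by blast
    show ?thesis unfolding empty by simp
  qed
  have [measurable]: "Measurable.pred (M \<Otimes>\<^sub>M borel) (\<lambda>x. snd x \<in> {f..<g (fst x)})"
    unfolding atLeastLessThan_iff by measurable
  interpret L: pair_sigma_finite M lborel by unfold_locales
  have int_p: "integrable M (\<lambda>x. g x powr p)"
  proof (rule integrable_const_bound[where B = "n powr p"])
    show "AE x in M. norm (g x powr p) \<le> n powr p"
      using p by (intro AE_I2) (simp add: powr_mono2 g0 gn)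
  qed simp
  have int_q: "integrable M (\<lambda>x. \<phi> x * g x powr (p - 1))"
  proof (rule Bochner_Integration.integrable_bound)
    show "integrable M (\<lambda>x. \<phi> x * n powr (p - 1))" using \<phi> by simp
    show "AE x in M. norm (\<phi> x * g x powr (p - 1)) \<le> norm (\<phi> x * n powr (p - 1))"
      using p by (intro AE_I2) (simp add: abs_mult mult_left_mono powr_mono2 g0 gn)
  qed simp
  have "ennreal ((LINT x|M. g x powr p) - f powr p) = ennreal (LINT x|M. g x powr p - f powr p)"
    using int_p by (simp add: prob_space)
  also have "\<dots> = (\<integral>\<^sup>+x. ennreal (g x powr p - f powr p) \<partial>M)"
    using int_p gf f p by (intro nn_integral_eq_integral[symmetric]) (auto intro!: AE_I2 powr_mono2)
  also have "\<dots> = (\<integral>\<^sup>+x. (\<integral>\<^sup>+l. ennreal (p * l powr (p - 1)) * indicator {f..<g x} l \<partial>lborel) \<partial>M)"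
    using f p gf by (intro nn_integral_cong nn_integral_powr_deriv[symmetric]) auto
  also have "\<dots> = (\<integral>\<^sup>+l. (\<integral>\<^sup>+x. ennreal (p * l powr (p - 1)) * indicator {f..<g x} l \<partial>M) \<partial>lborel)"
    by (rule L.Fubini'[symmetric]) measurable
  \<comment> \<open>One factor \<open>l\<close> is split off from \<open>l powr (p - 1)\<close>,
    because \<open>weak\<close> controls \<open>l\<close> times the measure of the level
    set.\<close>
  also have "\<dots> = (\<integral>\<^sup>+l. ennreal (p * l powr (p - 2)) * indicator {f..} l *
      (ennreal l * emeasure M {x \<in> space M. l < g x}) \<partial>lborel)"
  proof (intro nn_integral_cong)
    fix l :: real
    show "(\<integral>\<^sup>+x. ennreal (p * l powr (p - 1)) * indicator {f..<g x} l \<partial>M) =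
       ennreal (p * l powr (p - 2)) * indicator {f..} l * (ennreal l * emeasure M {x \<in> space M. l < g x})"
    proof (cases "f \<le> l")
      case True
      have "(\<integral>\<^sup>+x. ennreal (p * l powr (p - 1)) * indicator {f..<g x} l \<partial>M) =
        (\<integral>\<^sup>+x. ennreal (p * l powr (p - 1)) * indicator {x \<in> space M. l < g x} x \<partial>M)"
        using True by (intro nn_integral_cong) (auto split: split_indicator)
      also have "\<dots> = ennreal (p * l powr (p - 1)) * emeasure M {x \<in> space M. l < g x}"
        by (rule nn_integral_cmult_indicator) measurable
      finally have *: "(\<integral>\<^sup>+x. ennreal (p * l powr (p - 1)) * indicator {f..<g x} l \<partial>M) =
        ennreal (p * l powr (p - 1)) * emeasure M {x \<in> space M. l < g x}" .
      have "l powr (p - 1) = l powr (p - 2) * l"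
        using True f powr_add[of l "p - 2" 1] by (simp add: algebra_simps)
      then have "ennreal (p * l powr (p - 1)) = ennreal (p * l powr (p - 2)) * ennreal l"
        using p True f by (simp add: ennreal_mult[symmetric] mult.assoc)
      then show ?thesis unfolding * using True by (simp add: mult.assoc)
    qed simp
  qed
  also have "\<dots> \<le> (\<integral>\<^sup>+l. ennreal (p * l powr (p - 2)) * indicator {f..} l *
      (\<integral>\<^sup>+x. ennreal (\<phi> x) * indicator {x \<in> space M. l < g x} x \<partial>M) \<partial>lborel)"
  proof (intro nn_integral_mono)
    fix l :: real
    show "ennreal (p * l powr (p - 2)) * indicator {f..} l * (ennreal l * emeasure M {x \<in> space M. l < g x})
      \<le> ennreal (p * l powr (p - 2)) * indicator {f..} l *
        (\<integral>\<^sup>+x. ennreal (\<phi> x) * indicator {x \<in> space M. l < g x} x \<partial>M)"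
      using weak[of l] f by (cases "f \<le> l") (auto intro!: mult_left_mono)
  qed
  \<comment> \<open>Taking out \<open>p / (p - 1)\<close> leaves the kernel of
    \<open>nn_integral_powr_deriv\<close> for the exponent \<open>p - 1\<close>; Fubini then turns
    the integral over \<open>l\<close> into a difference of powers of \<open>g x\<close> and
    \<open>f\<close>.\<close>
  also have "\<dots> = (\<integral>\<^sup>+l. (\<integral>\<^sup>+x. ennreal (p / (p - 1)) * ennreal (\<phi> x) *
      (ennreal ((p - 1) * l powr (p - 1 - 1)) * indicator {f..<g x} l) \<partial>M) \<partial>lborel)"
  proof (intro nn_integral_cong)
    fix l :: real
    have "p * l powr (p - 2) = p / (p - 1) * ((p - 1) * l powr (p - 1 - 1))"
      using p by (simp add: diff_diff_eq)
    then have e: "ennreal (p * l powr (p - 2)) = ennreal (p / (p - 1)) * ennreal ((p - 1) * l powr (p - 1 - 1))"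
      using p by (simp add: ennreal_mult[symmetric])
    show "ennreal (p * l powr (p - 2)) * indicator {f..} l *
      (\<integral>\<^sup>+x. ennreal (\<phi> x) * indicator {x \<in> space M. l < g x} x \<partial>M) =
      (\<integral>\<^sup>+x. ennreal (p / (p - 1)) * ennreal (\<phi> x) *
      (ennreal ((p - 1) * l powr (p - 1 - 1)) * indicator {f..<g x} l) \<partial>M)"
      unfolding e
      by (subst nn_integral_cmult[symmetric], measurable)
         (auto intro!: nn_integral_cong simp: mult_ac split: split_indicator)
  qed
  also have "\<dots> = (\<integral>\<^sup>+x. (\<integral>\<^sup>+l. ennreal (p / (p - 1)) * ennreal (\<phi> x) *
      (ennreal ((p - 1) * l powr (p - 1 - 1)) * indicator {f..<g x} l) \<partial>lborel) \<partial>M)"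
    by (rule L.Fubini') measurable
  also have "\<dots> = (\<integral>\<^sup>+x. ennreal (p / (p - 1)) * ennreal (\<phi> x) *
      (\<integral>\<^sup>+l. ennreal ((p - 1) * l powr (p - 1 - 1)) * indicator {f..<g x} l \<partial>lborel) \<partial>M)"
    by (intro nn_integral_cong nn_integral_cmult) measurable
  also have "\<dots> = (\<integral>\<^sup>+x. ennreal (p / (p - 1) * (\<phi> x * g x powr (p - 1) - \<phi> x * f powr (p - 1))) \<partial>M)"
  proof (intro nn_integral_cong)
    fix x assume x: "x \<in> space M"
    have "(\<integral>\<^sup>+l. ennreal ((p - 1) * l powr (p - 1 - 1)) * indicator {f..<g x} l \<partial>lborel)
      = ennreal (g x powr (p - 1) - f powr (p - 1))"
      using f p gf[OF x] by (intro nn_integral_powr_deriv) auto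
    moreover have "f powr (p - 1) \<le> g x powr (p - 1)" using f p gf[OF x] by (intro powr_mono2) auto
    ultimately show "ennreal (p / (p - 1)) * ennreal (\<phi> x) *
      (\<integral>\<^sup>+l. ennreal ((p - 1) * l powr (p - 1 - 1)) * indicator {f..<g x} l \<partial>lborel) =
      ennreal (p / (p - 1) * (\<phi> x * g x powr (p - 1) - \<phi> x * f powr (p - 1)))"
      using p \<phi>(2)[OF x] by (simp add: ennreal_mult[symmetric] algebra_simps)
  qed
  also have "\<dots> = ennreal (LINT x|M. p / (p - 1) * (\<phi> x * g x powr (p - 1) - \<phi> x * f powr (p - 1)))"
  proof (rule nn_integral_eq_integral)
    show "integrable M (\<lambda>x. p / (p - 1) * (\<phi> x * g x powr (p - 1) - \<phi> x * f powr (p - 1)))"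
      using int_q \<phi> by simp
    have "\<phi> x * f powr (p - 1) \<le> \<phi> x * g x powr (p - 1)" if "x \<in> space M" for x
      using f p gf[OF that] \<phi>(2)[OF that] by (intro mult_left_mono powr_mono2) auto
    then show "AE x in M. 0 \<le> p / (p - 1) * (\<phi> x * g x powr (p - 1) - \<phi> x * f powr (p - 1))"
      using p by (intro AE_I2 mult_nonneg_nonneg) auto
  qed
  also have "(LINT x|M. p / (p - 1) * (\<phi> x * g x powr (p - 1) - \<phi> x * f powr (p - 1)))
    = p / (p - 1) * ((LINT x|M. \<phi> x * g x powr (p - 1)) - f * f powr (p - 1))"
    using int_q \<phi> f by simp
  also have "f * f powr (p - 1) = f powr p"
    using f powr_add[of f 1 "p - 1"] by simp
  finally have *: "ennreal ((LINT x|M. g x powr p) - f powr p)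
    \<le> ennreal (p / (p - 1) * ((LINT x|M. \<phi> x * g x powr (p - 1)) - f powr p))" .
  \<comment> \<open>The upper bound must be shown nonnegative before the \<open>ennreal\<close>
    inequality can be read off in the reals; this uses \<open>f \<le> g x\<close>.\<close>
  have "(LINT x|M. f powr (p - 1) * \<phi> x) \<le> (LINT x|M. \<phi> x * g x powr (p - 1))"
    using int_q \<phi> gf f p
    by (intro integral_mono) (auto intro!: mult_left_mono powr_mono2 simp: mult.commute)
  then have "f powr p \<le> (LINT x|M. \<phi> x * g x powr (p - 1))"
    using f \<phi> \<open>f * f powr (p - 1) = f powr p\<close> by (simp add: mult.commute)
  then have "0 \<le> p / (p - 1) * ((LINT x|M. \<phi> x * g x powr (p - 1)) - f powr p)"
    using p by (intro mult_nonneg_nonneg) auto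
  then have "(LINT x|M. g x powr p) - f powr p \<le> p / (p - 1) * ((LINT x|M. \<phi> x * g x powr (p - 1)) - f powr p)"
    using * by (simp add: ennreal_le_iff)
  then have "(p - 1) * ((LINT x|M. g x powr p) - f powr p)
      \<le> (p - 1) * (p / (p - 1) * ((LINT x|M. \<phi> x * g x powr (p - 1)) - f powr p))"
    using p by (intro mult_left_mono) auto
  also have "\<dots> = p * ((LINT x|M. \<phi> x * g x powr (p - 1)) - f powr p)" using p by simp
  finally show "(p - 1) * (LINT x|M. g x powr p) \<le> - (f powr p) + p * (LINT x|M. \<phi> x * g x powr (p - 1))"
    by (simp add: algebra_simps)
qed

end

section \<open>Young's inequality and removal of the truncation\<close>

text \<open>Young's inequality for the product of \<open>v = k * u / t\<close> and \<open>1\<close>,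
  with exponents \<open>q\<close> and \<open>q / (q - 1)\<close>, scaled by
  \<open>t powr p / k\<close>. It is an equality at \<open>u = t / k\<close>, which dictates
  \<open>k = \<beta> + 1\<close> later on.\<close>

lemma Young_powr_weighted:
  fixes u t k p q :: real
  assumes "0 \<le> u" "0 < t" "0 < k" "1 \<le> q"
  shows "u * t powr (p - 1)
    \<le> k powr (q - 1) / q * (u powr q * t powr (p - q)) + (q - 1) / (q * k) * t powr p"
proof -
  define v where "v = k * u / t"
  have v: "0 \<le> v" using assms by (simp add: v_def)
  have "v \<le> v powr q / q + (q - 1) / q"
  \<comment> \<open>For \<open>q = 1\<close> there is no finite conjugate exponent, and the claim
    reduces to \<open>v \<le> v\<close>.\<close>
  proof (cases "q = 1")
    case False
    then have "v * 1 \<le> v powr q / q + 1 powr (q / (q - 1)) / (q / (q - 1))"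
      using assms v by (intro Youngs_inequality) (auto simp: field_simps)
    then show ?thesis by simp
  qed (use v in simp)
  then have "t powr p / k * v \<le> t powr p / k * (v powr q / q + (q - 1) / q)"
    using assms by (intro mult_left_mono) auto
  moreover have "t powr p / k * v = u * t powr (p - 1)"
    using assms by (simp add: v_def powr_diff)
  moreover have "t powr p / k * (v powr q / q) = k powr (q - 1) / q * (u powr q * t powr (p - q))"
    using assms by (simp add: v_def powr_divide powr_mult powr_diff mult_ac)
  ultimately show ?thesis
    by (simp add: distrib_left mult_ac)
qed

context measure_tree begin

text \<open>Young's inequality produces a multiple of the integral of \<open>g powr p\<close> that
  is absorbed on the left, which is legitimate because the truncated integral is finite. The second
  conclusion allows the bound to be read in \<open>ereal\<close> later.\<close>

lemma maximal_Lp_upper: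
  fixes p q f \<beta> :: real
  assumes \<phi>: "integrable M \<phi>" "\<And>x. x \<in> space M \<Longrightarrow> 0 \<le> \<phi> x"
    and f: "(LINT x|M. \<phi> x) = f" "0 < f" and p: "1 < p" "1 \<le> q" "q \<le> p" and \<beta>: "0 < \<beta>"
  defines "D \<equiv> (p - 1) * q * \<beta> + (p - q)"
    and "Q \<equiv> \<integral>\<^sup>+x. ennreal (\<phi> x powr q) * ennreal_powr (tree_maximal M T \<phi> x) (p - q) \<partial>M"
  assumes Q: "Q \<noteq> \<infinity>"
  shows "(\<integral>\<^sup>+x. ennreal_powr (tree_maximal M T \<phi> x) p \<partial>M)
    \<le> ennreal (- (q * (\<beta> + 1) / D) * f powr p + p * (\<beta> + 1) powr q / D * enn2real Q)"
    and "0 \<le> - (q * (\<beta> + 1) / D) * f powr p + p * (\<beta> + 1) powr q / D * enn2real Q"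
proof -
  let ?m = "tree_maximal M T \<phi>"
  define R where "R = - (q * (\<beta> + 1) / D) * f powr p + p * (\<beta> + 1) powr q / D * enn2real Q"
  define g where "g n x = enn2real (min (?m x) (ennreal n))" for n x
  have "0 < (p - 1) * q * \<beta>" using p \<beta> by simp
  then have D: "0 < D" using p by (simp add: D_def)
  have m_meas [measurable]: "?m \<in> borel_measurable M"
    using tree_maximal_measurable \<phi> by blast
  have [measurable]: "\<phi> \<in> borel_measurable M" using \<phi> by simp
  have bound: "(\<integral>\<^sup>+x. ennreal (g n x powr p) \<partial>M) \<le> ennreal R" "0 \<le> R" if n: "f \<le> n" for n
  proof -
    have g: "\<And>x. x \<in> space M \<Longrightarrow> f \<le> g n x" "\<And>x. x \<in> space M \<Longrightarrow> g n x \<le> n"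
      "g n \<in> borel_measurable M"
      "(p - 1) * (LINT x|M. g n x powr p) \<le> - (f powr p) + p * (LINT x|M. \<phi> x * g n x powr (p - 1))"
      unfolding g_def using truncated_maximal_ineq[OF \<phi> f p(1) n] by blast+
    have [measurable]: "g n \<in> borel_measurable M" by (rule g)
    have g_pos: "0 < g n x" if "x \<in> space M" for x using g(1)[OF that] f by simp
    have gE: "ennreal (g n x) \<le> ?m x" for x
      unfolding g_def by (subst ennreal_enn2real) (auto simp: min_less_iff_disj)
    define N where "N = (LINT x|M. g n x powr p)"
    define P where "P = (LINT x|M. \<phi> x * g n x powr (p - 1))"
    have iN: "integrable M (\<lambda>x. g n x powr p)"
    proof (rule integrable_const_bound[where B = "n powr p"])
      show "AE x in M. norm (g n x powr p) \<le> n powr p"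
        using p g_pos by (intro AE_I2) (simp add: powr_mono2 g(2) less_imp_le)
    qed simp
    have iP: "integrable M (\<lambda>x. \<phi> x * g n x powr (p - 1))"
    proof (rule Bochner_Integration.integrable_bound)
      show "integrable M (\<lambda>x. \<phi> x * n powr (p - 1))" using \<phi> by simp
      show "AE x in M. norm (\<phi> x * g n x powr (p - 1)) \<le> norm (\<phi> x * n powr (p - 1))"
        using p g_pos by (intro AE_I2) (simp add: abs_mult mult_left_mono powr_mono2 g(2) less_imp_le)
    qed simp
    \<comment> \<open>For \<open>p = q\<close> both sides are \<open>1\<close>, since
      \<open>g n x\<close> is positive.\<close>
    have powr_le: "ennreal (g n x powr (p - q)) \<le> ennreal_powr (?m x) (p - q)" if x: "x \<in> space M" for x
    proof (cases "?m x = \<infinity> \<or> p = q")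
      case True
      then show ?thesis using g_pos[OF x] by (auto simp: ennreal_powr_def)
    next
      case False
      then have "g n x \<le> enn2real (?m x)"
        using gE[of x] by (metis enn2real_ennreal enn2real_mono g_pos infinity_ennreal_def less_imp_le top.not_eq_extremum x)
      then show ?thesis using False g_pos[OF x] p
        by (auto simp: ennreal_powr_def intro!: ennreal_leI powr_mono2)
    qed
    have "(\<integral>\<^sup>+x. ennreal (\<phi> x powr q * g n x powr (p - q)) \<partial>M) \<le> Q"
      unfolding Q_def using powr_le by (intro nn_integral_mono) (auto simp: ennreal_mult intro!: mult_left_mono)
    then have fin: "(\<integral>\<^sup>+x. ennreal (\<phi> x powr q * g n x powr (p - q)) \<partial>M) \<le> ennreal (enn2real Q)"
      using Q by (simp add: less_top)
    then have iQ: "integrable M (\<lambda>x. \<phi> x powr q * g n x powr (p - q))"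
      by (intro integrableI_nonneg) (auto simp: le_less_trans)
    define S where "S = (LINT x|M. \<phi> x powr q * g n x powr (p - q))"
    have S: "S \<le> enn2real Q"
      using fin nn_integral_eq_integral[OF iQ] by (simp add: S_def)
    have "P \<le> (LINT x|M. (\<beta> + 1) powr (q - 1) / q * (\<phi> x powr q * g n x powr (p - q))
        + (q - 1) / (q * (\<beta> + 1)) * g n x powr p)"
      unfolding P_def
    proof (rule integral_mono)
      fix x assume x: "x \<in> space M"
      show "\<phi> x * g n x powr (p - 1)
        \<le> (\<beta> + 1) powr (q - 1) / q * (\<phi> x powr q * g n x powr (p - q))
          + (q - 1) / (q * (\<beta> + 1)) * g n x powr p"
        using \<phi>(2)[OF x] g_pos[OF x] p \<beta> by (intro Young_powr_weighted) auto
    qed (intro iP Bochner_Integration.integrable_add integrable_mult_right iQ iN)+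
    also have "\<dots> = (\<beta> + 1) powr (q - 1) / q * S + (q - 1) / (q * (\<beta> + 1)) * N"
      using iQ iN by (simp add: S_def N_def)
    finally have P: "P \<le> (\<beta> + 1) powr (q - 1) / q * S + (q - 1) / (q * (\<beta> + 1)) * N" .
    have "(p - 1) * N \<le> - (f powr p) + p * P" using g(4) by (simp add: N_def P_def)
    also have "\<dots> \<le> - (f powr p) + p * ((\<beta> + 1) powr (q - 1) / q * S + (q - 1) / (q * (\<beta> + 1)) * N)"
      using P p by simp
    \<comment> \<open>Clearing denominators and collecting \<open>N\<close> leaves the coefficient
      \<open>(p - 1) * q * (\<beta> + 1) - p * (q - 1)\<close>, which is \<open>D\<close>.\<close>
    finally have "q * (\<beta> + 1) * ((p - 1) * N)
      \<le> q * (\<beta> + 1) * (- (f powr p) + p * ((\<beta> + 1) powr (q - 1) / q * S + (q - 1) / (q * (\<beta> + 1)) * N))"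
      using p \<beta> by (intro mult_left_mono) auto
    also have "\<dots> = - (q * (\<beta> + 1) * f powr p) + p * ((\<beta> + 1) * (\<beta> + 1) powr (q - 1)) * S + p * (q - 1) * N"
    proof -
      have "q * k * (- F + p * (z / q * S + (q - 1) / (q * k) * N))
        = - (q * k * F) + p * (k * z) * S + p * (q - 1) * N" if "0 < k" for k F z :: real
        using that p by (simp add: field_simps)
      then show ?thesis using \<beta> by simp
    qed
    also have "(\<beta> + 1) * (\<beta> + 1) powr (q - 1) = (\<beta> + 1) powr q"
      using \<beta> by (simp add: powr_diff)
    finally have "D * N \<le> - (q * (\<beta> + 1) * f powr p) + p * (\<beta> + 1) powr q * S"
      by (simp add: D_def algebra_simps)
    also have "\<dots> \<le> - (q * (\<beta> + 1) * f powr p) + p * (\<beta> + 1) powr q * enn2real Q"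
      using S p by (simp add: mult_left_mono)
    finally have "N \<le> R" using D by (simp add: R_def field_simps)
    moreover have "(\<integral>\<^sup>+x. ennreal (g n x powr p) \<partial>M) = ennreal N"
      unfolding N_def by (rule nn_integral_eq_integral) (use iN in auto)
    ultimately show "(\<integral>\<^sup>+x. ennreal (g n x powr p) \<partial>M) \<le> ennreal R" by (simp add: ennreal_leI)
    have "0 \<le> N" unfolding N_def by (intro integral_nonneg_AE) simp
    then show "0 \<le> R" using \<open>N \<le> R\<close> by simp
  qed
  \<comment> \<open>Where the maximal function is infinite the truncations equal \<open>n\<close>;
    elsewhere they are eventually constant.\<close>
  have lim: "(\<lambda>n. ennreal (g (real n) x powr p)) \<longlonglongrightarrow> ennreal_powr (?m x) p" for x
  proof (cases "?m x" rule: ennreal_cases)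
    case top
    have "filterlim (\<lambda>n. real n powr p) at_top sequentially" using p by real_asymp
    then have "(\<lambda>n. ennreal (real n powr p)) \<longlonglongrightarrow> \<infinity>"
      by (simp add: ennreal_tendsto_top_eq_at_top)
    then show ?thesis using top p by (simp add: g_def ennreal_powr_def)
  next
    case (real r)
    have "eventually (\<lambda>n. r \<le> real n) sequentially"
      using filterlim_real_sequentially by (simp add: filterlim_at_top)
    then have "eventually (\<lambda>n. ennreal (g (real n) x powr p) = ennreal_powr (?m x) p) sequentially"
    proof eventually_elim
      case (elim n)
      then have "min (ennreal r) (ennreal (real n)) = ennreal r" using real by (simp add: min_def ennreal_leI)
      then show ?case using real p by (simp add: g_def ennreal_powr_def)
    qed
    then show ?thesis by (rule tendsto_eventually)
  qed
  have [measurable]: "(\<lambda>x. ennreal (g n x powr p)) \<in> borel_measurable M" for n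
    unfolding g_def by measurable
  \<comment> \<open>Fatou's lemma carries the bound \<open>R\<close>, which does not depend on
    \<open>n\<close>, over to the maximal function itself.\<close>
  have "(\<integral>\<^sup>+x. ennreal_powr (?m x) p \<partial>M) = (\<integral>\<^sup>+x. liminf (\<lambda>n. ennreal (g (real n) x powr p)) \<partial>M)"
    using lim by (intro nn_integral_cong) (metis lim_imp_Liminf sequentially_bot)
  also have "\<dots> \<le> liminf (\<lambda>n. \<integral>\<^sup>+x. ennreal (g (real n) x powr p) \<partial>M)"
    by (rule nn_integral_liminf) measurable
  also have "\<dots> \<le> liminf (\<lambda>n. ennreal R)"
  proof (rule Liminf_mono)
    have "eventually (\<lambda>n. f \<le> real n) sequentially"
      using filterlim_real_sequentially by (simp add: filterlim_at_top)
    then show "eventually (\<lambda>n. (\<integral>\<^sup>+x. ennreal (g (real n) x powr p) \<partial>M) \<le> ennreal R) sequentially"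
      by eventually_elim (rule bound(1))
  qed
  also have "\<dots> = ennreal R" by (simp add: Liminf_const)
  finally show "(\<integral>\<^sup>+x. ennreal_powr (?m x) p \<partial>M)
    \<le> ennreal (- (q * (\<beta> + 1) / D) * f powr p + p * (\<beta> + 1) powr q / D * enn2real Q)"
    unfolding R_def .
  show "0 \<le> - (q * (\<beta> + 1) / D) * f powr p + p * (\<beta> + 1) powr q / D * enn2real Q"
    using bound(2)[OF order_refl] unfolding R_def .
qed

text \<open>The right-hand side has a negative summand and may be infinite, hence
  \<open>ereal\<close>. If \<open>f = 0\<close> the maximal function vanishes, and if the mixed
  integral is infinite so is the right-hand side, as its coefficient is positive.\<close>

lemma maximal_Lp_upper_ereal:
  fixes p q f \<beta> :: real
  assumes \<phi>: "integrable M \<phi>" "\<And>x. x \<in> space M \<Longrightarrow> 0 \<le> \<phi> x"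
    and f: "(LINT x|M. \<phi> x) = f" and p: "1 < p" "1 \<le> q" "q \<le> p" and \<beta>: "0 < \<beta>"
  shows "enn2ereal (\<integral>\<^sup>+x. ennreal_powr (tree_maximal M T \<phi> x) p \<partial>M)
            \<le> ereal (- (q * (\<beta> + 1) / ((p - 1) * q * \<beta> + (p - q))) * f powr p)
              + ereal (p * (\<beta> + 1) powr q / ((p - 1) * q * \<beta> + (p - q)))
                * enn2ereal (\<integral>\<^sup>+x. ennreal (\<phi> x powr q)
                                 * ennreal_powr (tree_maximal M T \<phi> x) (p - q) \<partial>M)"
    (is "enn2ereal ?N \<le> ereal (- ?A * f powr p) + ereal ?B * enn2ereal ?Q")
proof -
  have "0 < (p - 1) * q * \<beta>" using p \<beta> by simp
  then have D: "0 < (p - 1) * q * \<beta> + (p - q)" using p by simp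
  have A: "0 \<le> ?A" and B: "0 < ?B" using D p \<beta> by auto
  have "0 \<le> f" unfolding f[symmetric] using \<phi> by (intro integral_nonneg_AE) auto
  then consider "f = 0" | "0 < f" "?Q = \<infinity>" | "0 < f" "?Q \<noteq> \<infinity>" by fastforce
  then show ?thesis
  proof cases
    case 1
    have "tree_maximal M T \<phi> x \<le> 0" for x
    proof (rule tree_maximal_least)
      fix I assume I: "I \<in> T"
      have "(LINT x:I|M. \<phi> x) \<le> (LINT x|M. \<phi> x)"
        unfolding set_lebesgue_integral_def using \<phi> I
        by (intro integral_mono integrable_mult_indicator) (auto split: split_indicator)
      then have "Av M I \<phi> \<le> 0" using f 1 T_measure_pos[OF I] by (simp add: Av_def divide_le_0_iff)
      then show "ennreal (Av M I \<phi>) \<le> 0" by (simp add: ennreal_neg)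
    qed (rule \<phi>)
    then have "?N = 0" using p by (simp add: ennreal_powr_def)
    then show ?thesis using 1 B by (simp add: zero_ereal_def[symmetric] zero_ennreal.rep_eq)
  next
    case 2
    have "ereal b * enn2ereal \<infinity> = \<infinity>" if "0 < b" for b
      using that by (simp add: top_ennreal.rep_eq top_ereal_def)
    from this[OF B] show ?thesis unfolding 2(2) by simp
  next
    case 3
    note upper = maximal_Lp_upper[OF \<phi> f 3(1) p \<beta> 3(2)]
    have "enn2ereal ?N \<le> enn2ereal (ennreal (- ?A * f powr p + ?B * enn2real ?Q))"
      using upper(1) by (simp only: less_eq_ennreal.rep_eq)
    also have "\<dots> = ereal (- ?A * f powr p + ?B * enn2real ?Q)"
      using upper(2) by (rule enn2ereal_ennreal)
    also have "\<dots> = ereal (- ?A * f powr p) + ereal ?B * enn2ereal (ennreal (enn2real ?Q))"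
      by (subst enn2ereal_ennreal) simp_all
    also have "ennreal (enn2real ?Q) = ?Q" using 3(2) by (simp add: less_top)
    finally show ?thesis .
  qed
qed

end

section \<open>Sharpness\<close>

context measure_tree begin

text \<open>Serves both for the set \<open>I\<close> of the construction and for tree sets that are
  not properly contained in a member of \<open>F\<close>.\<close>

lemma set_integral_split_finite:
  fixes u :: "'a \<Rightarrow> real"
  assumes u: "integrable M u" and J: "J \<in> sets M" and F: "finite F" "F \<subseteq> sets M"
    and disj: "disjoint F" and nest: "\<forall>K\<in>F. K \<subseteq> J \<or> K \<inter> J = {}"
  shows "(LINT x:J|M. u x) = (\<Sum>K\<in>{K\<in>F. K \<subseteq> J}. LINT x:K|M. u x) + (LINT x:(J - \<Union>F)|M. u x)"
proof -
  let ?F = "{K \<in> F. K \<subseteq> J}"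
  have si: "set_integrable M E u" if "E \<in> sets M" for E
    unfolding set_integrable_def using u that by (rule integrable_mult_indicator[rotated])
  have m: "\<Union>F \<in> sets M" "(\<Union>K\<in>?F. K) \<in> sets M" using F by (auto intro!: sets.finite_Union)
  have "J = (\<Union>K\<in>?F. K) \<union> (J - \<Union>F)" using nest by blast
  then have "(LINT x:J|M. u x) = (LINT x:((\<Union>K\<in>?F. K) \<union> (J - \<Union>F))|M. u x)" by simp
  also have "\<dots> = (LINT x:(\<Union>K\<in>?F. K)|M. u x) + (LINT x:(J - \<Union>F)|M. u x)"
    by (rule set_integral_Un) (use m J in \<open>auto intro!: si\<close>)
  also have "(LINT x:(\<Union>K\<in>?F. K)|M. u x) = (\<Sum>K\<in>?F. LINT x:K|M. u x)"
    by (rule set_integral_finite_Union) (use F disj in \<open>auto simp: disjoint_family_on_def disjoint_def intro!: si\<close>)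
  finally show ?thesis .
qed

lemma set_integral_const: "E \<in> sets M \<Longrightarrow> (LINT x:E|M. (c::real)) = c * measure M E"
  by (simp add: set_lebesgue_integral_def)

text \<open>\<open>R\<close> bounds the ratio of the maximal function to \<open>g\<close>. In the
  application \<open>B\<close> is the second constant of the inequality times
  \<open>R powr (p - q)\<close>, the price of replacing the maximal function by \<open>g\<close> in
  the mixed integral. The local constancy demanded below yields goodness.\<close>

context
  fixes p q B R :: real
begin

text \<open>\<open>g\<close> is comparable to the maximal function of \<open>\<phi>\<close> over the tree sets inside \<open>I\<close>, and
  \<open>d\<close> bounds the defect of the integral inequality on \<open>I\<close>.\<close>

definition profile :: "'a set \<Rightarrow> real \<Rightarrow> real \<Rightarrow> ('a \<Rightarrow> real) \<Rightarrow> ('a \<Rightarrow> real) \<Rightarrow> bool" where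
  "profile I y d \<phi> g \<longleftrightarrow>
     \<phi> \<in> borel_measurable M \<and> g \<in> borel_measurable M \<and>
     (\<exists>Z. \<forall>x. 0 \<le> \<phi> x \<and> \<phi> x \<le> Z \<and> 0 \<le> g x \<and> g x \<le> Z) \<and>
     (LINT x:I|M. \<phi> x) = y * measure M I \<and>
     (\<forall>x\<in>I. y \<le> g x) \<and>
     (\<forall>x\<in>I. \<exists>J\<in>T. x \<in> J \<and> J \<subseteq> I \<and> g x \<le> Av M J \<phi>) \<and>
     (\<forall>x\<in>I. \<forall>J\<in>T. x \<in> J \<longrightarrow> J \<subseteq> I \<longrightarrow> Av M J \<phi> \<le> R * g x) \<and>
     (\<forall>x\<in>I. \<exists>J\<in>T. x \<in> J \<and> J \<subseteq> I \<and> (\<forall>z\<in>J. \<phi> z = \<phi> x)) \<and>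
     - d * y powr p * measure M I
       \<le> (LINT x:I|M. g x powr p - B * (\<phi> x powr q * g x powr (p - q)))"

lemma profileD:
  assumes "profile I y d \<phi> g"
  shows "\<phi> \<in> borel_measurable M" "g \<in> borel_measurable M"
    "\<exists>Z. \<forall>x. 0 \<le> \<phi> x \<and> \<phi> x \<le> Z \<and> 0 \<le> g x \<and> g x \<le> Z"
    "(LINT x:I|M. \<phi> x) = y * measure M I"
    "\<forall>x\<in>I. y \<le> g x"
    "\<forall>x\<in>I. \<exists>J\<in>T. x \<in> J \<and> J \<subseteq> I \<and> g x \<le> Av M J \<phi>"
    "\<forall>x\<in>I. \<forall>J\<in>T. x \<in> J \<longrightarrow> J \<subseteq> I \<longrightarrow> Av M J \<phi> \<le> R * g x"
    "\<forall>x\<in>I. \<exists>J\<in>T. x \<in> J \<and> J \<subseteq> I \<and> (\<forall>z\<in>J. \<phi> z = \<phi> x)"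
    "- d * y powr p * measure M I
       \<le> (LINT x:I|M. g x powr p - B * (\<phi> x powr q * g x powr (p - q)))"
  using assms unfolding profile_def by - (elim conjE, assumption)+

lemma profile_mono: "profile I y d \<phi> g \<Longrightarrow> d \<le> d' \<Longrightarrow> profile I y d' \<phi> g"
  unfolding profile_def
  by (elim conjE, intro conjI, assumption+) (erule order_trans[rotated], simp add: mult_right_mono)

text \<open>Start of the recursion: the integrand is \<open>(1 - B) * y powr p\<close>, so the
  defect is exactly \<open>B - 1\<close>.\<close>

lemma profile_const:
  assumes I: "I \<in> T" and y: "0 < y" and R: "1 \<le> R"
  shows "profile I y (B - 1) (\<lambda>_. y) (\<lambda>_. y)"
proof -
  have Av: "Av M J (\<lambda>_. y) = y" if "J \<in> T" for J using that by (rule Av_const) simp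
  have "y powr q * y powr (p - q) = y powr p" using y by (simp add: powr_diff)
  then have "(LINT x:I|M. y powr p - B * (y powr q * y powr (p - q))) = - (B - 1) * y powr p * measure M I"
    by (subst set_integral_const) (use I in \<open>auto simp: algebra_simps\<close>)
  moreover have "(LINT x:I|M. y) = y * measure M I" using I by (simp add: set_integral_const)
  moreover have "y \<le> R * y" using y R by simp
  moreover have "\<exists>Z. \<forall>x::'a. 0 \<le> y \<and> y \<le> Z \<and> 0 \<le> y \<and> y \<le> Z"
    using y by (intro exI[of _ y]) simp
  ultimately show ?thesis
    unfolding profile_def using I Av by (simp, blast)
qed

lemma profile_integrable:
  assumes "profile I y d \<phi> g" "1 \<le> q" "q \<le> p"
  shows "integrable M \<phi>" "integrable M (\<lambda>x. g x powr p)"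
    "integrable M (\<lambda>x. \<phi> x powr q * g x powr (p - q))"
proof -
  have [measurable]: "\<phi> \<in> borel_measurable M" "g \<in> borel_measurable M"
    using profileD(1,2)[OF assms(1)] .
  obtain Z where Z: "\<And>x. 0 \<le> \<phi> x" "\<And>x. \<phi> x \<le> Z" "\<And>x. 0 \<le> g x" "\<And>x. g x \<le> Z"
    using profileD(3)[OF assms(1)] by blast
  show "integrable M \<phi>"
    by (rule integrable_const_bound[where B = Z]) (auto simp: Z)
  show "integrable M (\<lambda>x. g x powr p)"
    by (rule integrable_const_bound[where B = "Z powr p"])
       (use assms in \<open>auto simp: Z powr_mono2\<close>)
  show "integrable M (\<lambda>x. \<phi> x powr q * g x powr (p - q))"
    by (rule integrable_const_bound[where B = "Z powr q * Z powr (p - q)"])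
       (use assms in \<open>auto simp: Z powr_mono2 abs_mult intro!: mult_mono\<close>)
qed

text \<open>Off the members of \<open>F\<close> take \<open>\<phi> = b * y\<close> and
  \<open>g = y\<close>; on each member take its own pair. The value of \<open>r\<close> solves
  \<open>s * b + (1 - s) * r = 1\<close>, which keeps the average over \<open>I\<close> at
  \<open>y\<close>. The two regions contribute \<open>s * (B * b powr q - 1)\<close> and
  \<open>d * (1 - s) * r powr p\<close> to the defect.\<close>

lemma profile_step:
  assumes pq: "1 \<le> q" "q \<le> p"
    and I: "I \<in> T" and y: "0 < y" and F: "finite F" "F \<subseteq> level k" "\<Union>F \<subseteq> I"
    and level_I: "\<And>J. J \<in> level k \<Longrightarrow> J \<inter> I \<noteq> {} \<Longrightarrow> J \<subseteq> I"
    and s: "measure M (\<Union>F) = (1 - s) * measure M I" "0 < s" "s < 1"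
    and b: "0 \<le> b" "b \<le> 1" and r: "r = (1 - b * s) / (1 - s)" "r \<le> R"
    and prof: "\<And>K. K \<in> F \<Longrightarrow> profile K (r * y) d (\<Phi> K) (G K)"
  shows "\<exists>\<phi> g. profile I y (s * (B * b powr q - 1) + d * (1 - s) * r powr p) \<phi> g"
proof -
  have FT: "K \<in> T" if "K \<in> F" for K using that F level_T by blast
  have disj: "K = K'" if "K \<in> F" "K' \<in> F" "K \<inter> K' \<noteq> {}" for K K'
    using level_disjoint that F by blast
  have disjF: "disjoint F" unfolding disjoint_def using disj by blast
  have r1: "1 \<le> r" using s b by (simp add: r mult_left_le_one_le)
  have UF: "\<Union>F \<in> sets M" using F FT by (intro sets.finite_Union) auto
  \<comment> \<open>As \<open>F\<close> is disjoint, the sum has a single nonzero term at most; in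
    this form measurability is immediate.\<close>
  define glue where "glue \<Psi> v x = (if x \<in> \<Union>F then \<Sum>K\<in>F. indicator K x * \<Psi> K x else v)"
    for \<Psi> :: "'a set \<Rightarrow> 'a \<Rightarrow> real" and v :: real and x
  have glue_in: "glue \<Psi> v x = \<Psi> K x" if K: "K \<in> F" "x \<in> K" for \<Psi> v x K
  proof -
    have "(\<Sum>L\<in>F. indicator L x * \<Psi> L x) = (\<Sum>L\<in>F. if L = K then \<Psi> K x else 0)"
      using disj K by (intro sum.cong) (auto simp: indicator_def)
    then show ?thesis using K F by (auto simp: glue_def)
  qed
  have glue_out: "glue \<Psi> v x = v" if "x \<notin> \<Union>F" for \<Psi> v x using that by (simp add: glue_def)
  have glue_meas: "glue \<Psi> v \<in> borel_measurable M" if "\<And>K. K \<in> F \<Longrightarrow> \<Psi> K \<in> borel_measurable M" for \<Psi> v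
  proof -
    have "(\<lambda>x. \<Sum>K\<in>F. indicator K x * \<Psi> K x) \<in> borel_measurable M"
      using that FT by (intro borel_measurable_sum borel_measurable_times) auto
    then show ?thesis unfolding glue_def using UF by measurable
  qed
  have glue_bounds: "0 \<le> glue \<Psi> v x \<and> glue \<Psi> v x \<le> v + sum Z F"
    if bd: "0 \<le> v" "\<And>K x. K \<in> F \<Longrightarrow> 0 \<le> \<Psi> K x \<and> \<Psi> K x \<le> Z K" for \<Psi> v x Z
  proof -
    \<comment> \<open>The bounds hold at every point, so an arbitrary one shows that
      \<open>Z K\<close> is nonnegative.\<close>
    have Z: "0 \<le> Z K" if "K \<in> F" for K using bd(2)[OF that, of undefined] by linarith
    show ?thesis
    proof (cases "x \<in> \<Union>F")
      case True
      then obtain K where K: "K \<in> F" "x \<in> K" by blast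
      have "Z K \<le> sum Z F" using K Z F by (intro member_le_sum) auto
      then show ?thesis using glue_in[OF K, of \<Psi> v] bd(2)[OF K(1), of x] bd(1) by simp
    next
      case False
      then show ?thesis using bd(1) Z by (simp add: glue_out sum_nonneg)
    qed
  qed
  define \<phi> where "\<phi> = glue \<Phi> (b * y)"
  define g where "g = glue G y"
  have [measurable]: "\<phi> \<in> borel_measurable M" "g \<in> borel_measurable M"
    unfolding \<phi>_def g_def using profileD(1,2)[OF prof] by (intro glue_meas; blast)+
  have "\<forall>K\<in>F. \<exists>Z. \<forall>x. 0 \<le> \<Phi> K x \<and> \<Phi> K x \<le> Z \<and> 0 \<le> G K x \<and> G K x \<le> Z"
    using prof by (auto simp: profile_def)
  then obtain Z where Z: "\<And>K x. K \<in> F \<Longrightarrow> 0 \<le> \<Phi> K x \<and> \<Phi> K x \<le> Z K \<and> 0 \<le> G K x \<and> G K x \<le> Z K"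
    by metis
  have bounds: "0 \<le> \<phi> x \<and> \<phi> x \<le> y + sum Z F \<and> 0 \<le> g x \<and> g x \<le> y + sum Z F" for x
  proof -
    have "0 \<le> b * y" "b * y \<le> y" using b y by (auto simp: mult_left_le_one_le)
    moreover have "0 \<le> glue \<Phi> (b * y) x \<and> glue \<Phi> (b * y) x \<le> b * y + sum Z F"
      using \<open>0 \<le> b * y\<close> Z by (intro glue_bounds) auto
    moreover have "0 \<le> glue G y x \<and> glue G y x \<le> y + sum Z F"
      using y Z by (intro glue_bounds) auto
    ultimately show ?thesis unfolding \<phi>_def g_def by linarith
  qed
  have int_\<phi>: "integrable M \<phi>"
    by (rule integrable_const_bound[where B = "y + sum Z F"]) (use bounds in auto)
  define h where "h = (\<lambda>x. g x powr p - B * (\<phi> x powr q * g x powr (p - q)))"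
  have int_h: "integrable M h"
  proof -
    let ?Z = "y + sum Z F"
    have "integrable M (\<lambda>x. g x powr p)"
      by (rule integrable_const_bound[where B = "?Z powr p"])
         (use bounds pq in \<open>auto simp: powr_mono2\<close>)
    moreover have "integrable M (\<lambda>x. \<phi> x powr q * g x powr (p - q))"
      by (rule integrable_const_bound[where B = "?Z powr q * ?Z powr (p - q)"])
         (use bounds pq in \<open>auto simp: powr_mono2 abs_mult intro!: mult_mono\<close>)
    ultimately show ?thesis unfolding h_def by simp
  qed
  have Fs: "F \<subseteq> sets M" using FT by auto
  note split = set_integral_split_finite[OF _ _ F(1) Fs disjF]
  have int_K: "(LINT x:K|M. \<phi> x) = r * y * measure M K" if K: "K \<in> F" for K
  proof -
    have "(LINT x:K|M. \<phi> x) = (LINT x:K|M. \<Phi> K x)"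
      by (rule set_lebesgue_integral_cong) (use K FT in \<open>auto simp: \<phi>_def glue_in\<close>)
    then show ?thesis using profileD(4)[OF prof[OF K]] by simp
  qed
  have int_out: "(LINT x:(J - \<Union>F)|M. \<phi> x) = b * y * measure M (J - \<Union>F)" if J: "J \<in> sets M" for J
  proof -
    have "(LINT x:(J - \<Union>F)|M. \<phi> x) = (LINT x:(J - \<Union>F)|M. b * y)"
      by (rule set_lebesgue_integral_cong) (use J UF in \<open>auto simp: \<phi>_def glue_out\<close>)
    then show ?thesis using J UF by (simp add: set_integral_const)
  qed
  have FI: "{K \<in> F. K \<subseteq> I} = F" using F by auto
  have mF: "(\<Sum>K\<in>F. measure M K) = (1 - s) * measure M I"
  proof -
    have "disjoint_family_on (\<lambda>K. K) F" unfolding disjoint_family_on_def using disj by blast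
    then show ?thesis using finite_measure_finite_Union[of F "\<lambda>K. K"] F Fs s by simp
  qed
  have mI: "measure M (I - \<Union>F) = s * measure M I"
    using finite_measure_Diff[of I "\<Union>F"] I UF F s by (simp add: algebra_simps)
  have I_nest: "\<forall>K\<in>F. K \<subseteq> I \<or> K \<inter> I = {}" using F by blast
  have "(LINT x:I|M. \<phi> x) = (\<Sum>K\<in>F. r * y * measure M K) + b * y * measure M (I - \<Union>F)"
    using split[OF int_\<phi> _ I_nest] I int_K int_out[of I] by (simp add: FI)
  also have "\<dots> = r * (1 - s) * y * measure M I + b * y * s * measure M I"
    by (simp add: sum_distrib_left[symmetric] mF mI)
  also have "r * (1 - s) = 1 - b * s" using s by (simp add: r)
  finally have avg: "(LINT x:I|M. \<phi> x) = y * measure M I" by (simp add: algebra_simps)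
  \<comment> \<open>Such a \<open>J\<close> consists of whole members of \<open>F\<close>, with
    average \<open>r * y\<close>, and of points where
    \<open>\<phi> = b * y \<le> r * y\<close>.\<close>
  have large: "Av M J \<phi> \<le> r * y" if J: "J \<in> T" "\<And>K. K \<in> F \<Longrightarrow> J \<subseteq> K \<Longrightarrow> J = K" for J
  proof -
    have nest: "\<forall>K\<in>F. K \<subseteq> J \<or> K \<inter> J = {}"
      using T_nested[OF FT J(1)] J(2) by blast
    have "(LINT x:J|M. \<phi> x) = (\<Sum>K\<in>{K\<in>F. K \<subseteq> J}. LINT x:K|M. \<phi> x) + (LINT x:(J - \<Union>F)|M. \<phi> x)"
      using J(1) by (intro split int_\<phi> nest) auto
    also have "\<dots> \<le> (\<Sum>K\<in>{K\<in>F. K \<subseteq> J}. LINT x:K|M. r * y) + (LINT x:(J - \<Union>F)|M. r * y)"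
    proof (intro add_mono sum_mono)
      fix K assume "K \<in> {K \<in> F. K \<subseteq> J}"
      then show "(LINT x:K|M. \<phi> x) \<le> (LINT x:K|M. r * y)" using int_K FT by (simp add: set_integral_const)
    next
      have "b * y \<le> r * y" using b r1 y by (intro mult_right_mono) auto
      then show "(LINT x:(J - \<Union>F)|M. \<phi> x) \<le> (LINT x:(J - \<Union>F)|M. r * y)"
        unfolding int_out[OF T_measurable[OF J(1)]] set_integral_const[OF sets.Diff[OF T_measurable[OF J(1)] UF]]
        by (rule mult_right_mono) simp
    qed
    also have "\<dots> = (LINT x:J|M. r * y)"
      using J(1) by (intro split[symmetric] nest) auto
    also have "\<dots> = r * y * measure M J" using J(1) by (simp add: set_integral_const)
    finally show ?thesis using T_measure_pos[OF J(1)] by (simp add: Av_def divide_le_eq)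
  qed
  have Av_in: "Av M J \<phi> = Av M J (\<Phi> K)" if "K \<in> F" "J \<in> T" "J \<subseteq> K" for J K
    using that by (intro Av_cong) (auto simp: \<phi>_def glue_in)
  have h_in: "(LINT x:K|M. h x) \<ge> - d * (r * y) powr p * measure M K" if K: "K \<in> F" for K
  proof -
    have "(LINT x:K|M. h x)
      = (LINT x:K|M. G K x powr p - B * (\<Phi> K x powr q * G K x powr (p - q)))"
      by (rule set_lebesgue_integral_cong) (use K FT in \<open>auto simp: h_def g_def \<phi>_def glue_in\<close>)
    then show ?thesis using profileD(9)[OF prof[OF K]] by simp
  qed
  have h_out: "(LINT x:(I - \<Union>F)|M. h x) = y powr p * (1 - B * b powr q) * (s * measure M I)"
  proof -
    have "(LINT x:(I - \<Union>F)|M. h x) = (LINT x:(I - \<Union>F)|M. y powr p - B * ((b * y) powr q * y powr (p - q)))"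
      by (rule set_lebesgue_integral_cong) (use I UF in \<open>auto simp: h_def g_def \<phi>_def glue_out\<close>)
    also have "(b * y) powr q * y powr (p - q) = b powr q * y powr p"
      using b y by (simp add: powr_mult powr_diff)
    also have "(LINT x:(I - \<Union>F)|M. y powr p - B * (b powr q * y powr p))
      = (y powr p - B * (b powr q * y powr p)) * measure M (I - \<Union>F)"
      using I UF by (intro set_integral_const) auto
    finally show ?thesis by (simp add: mI algebra_simps)
  qed
  have "- (s * (B * b powr q - 1) + d * (1 - s) * r powr p) * y powr p * measure M I
    = - d * (r * y) powr p * ((1 - s) * measure M I) + y powr p * (1 - B * b powr q) * (s * measure M I)"
    using r1 y by (simp add: powr_mult algebra_simps)
  also have "\<dots> = (\<Sum>K\<in>F. - d * (r * y) powr p * measure M K) + (LINT x:(I - \<Union>F)|M. h x)"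
    by (simp only: h_out mF[symmetric] sum_distrib_left)
  also have "\<dots> \<le> (\<Sum>K\<in>F. LINT x:K|M. h x) + (LINT x:(I - \<Union>F)|M. h x)"
    by (intro add_mono sum_mono h_in order_refl)
  also have "\<dots> = (LINT x:I|M. h x)"
    using split[OF int_h _ I_nest] I by (simp add: FI)
  finally have defect: "- (s * (B * b powr q - 1) + d * (1 - s) * r powr p) * y powr p * measure M I
    \<le> (LINT x:I|M. h x)" .
  have g_ge: "y \<le> g x" for x
  proof (cases "x \<in> \<Union>F")
    case True
    then obtain K where K: "K \<in> F" "x \<in> K" by blast
    have "y \<le> r * y" using r1 y by simp
    also have "\<dots> \<le> G K x" using profileD(5)[OF prof[OF K(1)]] K(2) by blast
    finally show ?thesis by (simp add: g_def glue_in[OF K])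
  qed (simp add: g_def glue_out)
  have lower: "\<exists>J\<in>T. x \<in> J \<and> J \<subseteq> I \<and> g x \<le> Av M J \<phi>" if x: "x \<in> I" for x
  proof (cases "x \<in> \<Union>F")
    case True
    then obtain K where K: "K \<in> F" "x \<in> K" by blast
    then obtain J where J: "J \<in> T" "x \<in> J" "J \<subseteq> K" "G K x \<le> Av M J (\<Phi> K)"
      using profileD(6)[OF prof[OF K(1)]] by blast
    then have "g x \<le> Av M J \<phi>" using Av_in[OF K(1) J(1,3)] by (simp add: g_def glue_in[OF K])
    then show ?thesis using J K F by blast
  next
    case False
    \<comment> \<open>Off \<open>F\<close> the set \<open>I\<close> itself is the witness, as its
      average is \<open>y\<close>.\<close>
    then have "g x \<le> Av M I \<phi>" using avg T_measure_pos[OF I] by (simp add: g_def glue_out Av_def)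
    then show ?thesis using x I by blast
  qed
  \<comment> \<open>Tree sets inside a member of \<open>F\<close> are covered by the profile there;
    all others fall under \<open>large\<close>.\<close>
  have upper: "Av M J \<phi> \<le> R * g x" if x: "x \<in> I" and J: "J \<in> T" "x \<in> J" "J \<subseteq> I" for x J
  proof (cases "\<exists>K\<in>F. J \<subseteq> K")
    case True
    then obtain K where K: "K \<in> F" "J \<subseteq> K" by blast
    then have "Av M J (\<Phi> K) \<le> R * G K x" using profileD(7)[OF prof[OF K(1)]] J by blast
    then show ?thesis using Av_in[OF K(1) J(1) K(2)] glue_in[of K x] K J by (auto simp: g_def)
  next
    case False
    then have "Av M J \<phi> \<le> r * y" by (intro large J) blast
    also have "\<dots> \<le> R * g x" using r r1 y g_ge[of x] by (intro mult_mono) auto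
    finally show ?thesis .
  qed
  have const: "\<exists>J\<in>T. x \<in> J \<and> J \<subseteq> I \<and> (\<forall>z\<in>J. \<phi> z = \<phi> x)" if x: "x \<in> I" for x
  proof (cases "x \<in> \<Union>F")
    case True
    then obtain K where K: "K \<in> F" "x \<in> K" by blast
    then obtain J where J: "J \<in> T" "x \<in> J" "J \<subseteq> K" "\<forall>z\<in>J. \<Phi> K z = \<Phi> K x"
      using profileD(8)[OF prof[OF K(1)]] by blast
    have eq: "\<phi> z = \<Phi> K z" if "z \<in> K" for z using glue_in[OF K(1) that] by (simp add: \<phi>_def)
    have "\<phi> z = \<phi> x" if z: "z \<in> J" for z
    proof -
      have "\<phi> z = \<Phi> K z" using z J(3) by (intro eq) blast
      also have "\<dots> = \<Phi> K x" using J(4) z by blast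
      also have "\<dots> = \<phi> x" by (rule eq[OF K(2), symmetric])
      finally show ?thesis .
    qed
    then have "\<forall>z\<in>J. \<phi> z = \<phi> x" by (rule ballI)
    moreover have "J \<subseteq> I" using J(3) K(1) F(3) by blast
    ultimately show ?thesis using J(1,2) by (intro bexI[of _ J] conjI)
  next
    case False
    \<comment> \<open>The members of \<open>F\<close> all lie on level \<open>k\<close>, so the
      level-\<open>k\<close> set through a point outside them misses them all and
      \<open>\<phi>\<close> is constant on it.\<close>
    obtain J where J: "J \<in> level k" "x \<in> J" using level_cover[of x k] T_space[OF I] x by blast
    then have "J \<subseteq> I" using level_I x by blast
    have "J \<inter> K = {}" if K: "K \<in> F" for K
    proof (rule ccontr)
      assume "J \<inter> K \<noteq> {}"
      then have "J = K" using level_disjoint[of J k K] J(1) K F(2) by blast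
      then show False using False J(2) K by blast
    qed
    then have "z \<notin> \<Union>F" if "z \<in> J" for z using that by blast
    then have "\<forall>z\<in>J. \<phi> z = \<phi> x" using False by (simp add: \<phi>_def glue_out)
    then show ?thesis using J(2) \<open>J \<subseteq> I\<close> level_T[OF J(1)] by (intro bexI[of _ J] conjI)
  qed
  have "profile I y (s * (B * b powr q - 1) + d * (1 - s) * r powr p) \<phi> g"
    unfolding profile_def
  proof (intro conjI ballI impI)
    show "\<exists>Z. \<forall>x. 0 \<le> \<phi> x \<and> \<phi> x \<le> Z \<and> 0 \<le> g x \<and> g x \<le> Z" using bounds by blast
    show "- (s * (B * b powr q - 1) + d * (1 - s) * r powr p) * y powr p * measure M I
      \<le> (LINT x:I|M. g x powr p - B * (\<phi> x powr q * g x powr (p - q)))"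
      using defect unfolding h_def .
  qed (use avg g_ge lower upper const in simp_all)
  then show ?thesis by blast
qed

text \<open>Each round shrinks the excess of the defect over \<open>c\<close> by the factor
  \<open>1 - \<eta>\<close>. The removed fraction \<open>s\<close> is known only up to the window
  from \<open>s0 / 2\<close> to \<open>s0\<close>, so \<open>contract\<close> covers all of it. The
  induction varies \<open>y\<close>, since the members carry the average
  \<open>r * y\<close>.\<close>

lemma profile_iterate:
  assumes pq: "1 \<le> q" "q \<le> p" and b: "0 \<le> b" "b \<le> 1" and s0: "0 < s0" "s0 < 1"
    and R: "R = (1 - b * s0) / (1 - s0)" and e: "0 \<le> e" "B - 1 \<le> c + e" and \<eta>: "\<eta> \<le> 1"
    and contract: "\<And>s d. s0 / 2 \<le> s \<Longrightarrow> s \<le> s0 \<Longrightarrow> c \<le> d \<Longrightarrow>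
      s * (B * b powr q - 1) + d * (1 - s) * ((1 - b * s) / (1 - s)) powr p \<le> c + (1 - \<eta>) * (d - c)"
    and I: "I \<in> T" and y: "0 < y"
  shows "\<exists>\<phi> g. profile I y (c + (1 - \<eta>) ^ n * e) \<phi> g"
  using I y
proof (induction n arbitrary: I y)
  case 0
  have "1 \<le> R" using s0 b by (simp add: R mult_left_le_one_le)
  then show ?case using profile_mono[OF profile_const[OF 0] e(2)] by auto
next
  case (Suc n)
  obtain k F where F: "finite F" "F \<subseteq> level k" "\<Union>F \<subseteq> I"
      "\<And>J. J \<in> level k \<Longrightarrow> J \<inter> I \<noteq> {} \<Longrightarrow> J \<subseteq> I"
    and mF: "(1 - s0) * measure M I \<le> measure M (\<Union>F)" "measure M (\<Union>F) \<le> (1 - s0 / 2) * measure M I"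
    using finite_subfamily[OF Suc.prems(1) s0] by metis
  note mI = T_measure_pos[OF Suc.prems(1)]
  define s where "s = 1 - measure M (\<Union>F) / measure M I"
  have s: "measure M (\<Union>F) = (1 - s) * measure M I" "s0 / 2 \<le> s" "s \<le> s0"
    using mF mI by (auto simp: s_def field_simps)
  define r where "r = (1 - b * s) / (1 - s)"
  \<comment> \<open>In this form the ratio is visibly increasing in \<open>t\<close>, so its value
    at \<open>s0\<close> bounds \<open>r\<close>.\<close>
  have r_eq: "(1 - b * t) / (1 - t) = b + (1 - b) / (1 - t)" if "t < 1" for t
    using that by (simp add: field_simps)
  have "(1 - b) / (1 - s) \<le> (1 - b) / (1 - s0)" using s s0 b by (intro divide_left_mono) auto
  then have rR: "r \<le> R" using s s0 by (simp add: r_def R r_eq)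
  have "b * s \<le> s" using b s s0 by (intro mult_left_le_one_le) auto
  then have "0 < 1 - b * s" using s s0 by linarith
  then have "0 < r * y" using s s0 Suc.prems by (simp add: r_def)
  then have "\<forall>K\<in>F. \<exists>\<phi> g. profile K (r * y) (c + (1 - \<eta>) ^ n * e) \<phi> g"
    using Suc.IH F(2) level_T by blast
  then obtain \<Phi> G where "\<And>K. K \<in> F \<Longrightarrow> profile K (r * y) (c + (1 - \<eta>) ^ n * e) (\<Phi> K) (G K)"
    by metis
  then obtain \<phi> g where prof: "profile I y (s * (B * b powr q - 1)
      + (c + (1 - \<eta>) ^ n * e) * (1 - s) * r powr p) \<phi> g"
    using profile_step[OF pq Suc.prems F s(1) _ _ b r_def rR] s s0 by fastforce
  have "c \<le> c + (1 - \<eta>) ^ n * e" using \<eta> e by simp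
  from contract[OF s(2,3) this]
  have "s * (B * b powr q - 1) + (c + (1 - \<eta>) ^ n * e) * (1 - s) * r powr p \<le> c + (1 - \<eta>) ^ Suc n * e"
    by (simp add: r_def mult.assoc)
  then show ?case using profile_mono[OF prof] by blast
qed

end

end

section \<open>Choice of the parameters of the construction\<close>

text \<open>With \<open>A\<close> and \<open>B\<close> the two constants of the inequality, the function
  \<open>B x\<^sup>q - 1 - A (p x - (p - 1))\<close> vanishes together with its derivative at \<open>x = 1 / (\<beta> + 1)\<close>.\<close>

lemma extremal_slope:
  fixes p q \<beta> c :: real
  assumes p: "1 < p" "1 \<le> q" "q \<le> p" and \<beta>: "0 < \<beta>" "\<beta> \<le> 1 / (p - 1)"
  defines "D \<equiv> (p - 1) * q * \<beta> + (p - q)"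
  assumes c: "q * (\<beta> + 1) / D < c"
  obtains b where "0 < b" "b < 1" "0 < p * b - (p - 1)"
    "p * (\<beta> + 1) powr q / D * b powr q - 1 < c * (p * b - (p - 1))"
proof -
  define k where "k = \<beta> + 1"
  have k: "1 < k" using \<beta> by (simp add: k_def)
  have "0 < (p - 1) * q * \<beta>" using p \<beta> by simp
  then have D: "0 < D" using p by (simp add: D_def)
  \<comment> \<open>The upper bound on \<open>\<beta>\<close> enters here: it gives the slope factor
    at \<open>1 / k\<close> the sign needed to replace \<open>A\<close> by the larger
    \<open>c\<close>.\<close>
  have "\<beta> * (p - 1) \<le> 1" using \<beta> p by (simp add: pos_le_divide_eq)
  then have pa: "0 \<le> p / k - (p - 1)"
    using k by (simp add: k_def field_simps)
  define A where "A = q * k / D"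
  define Bc where "Bc = p * k powr q / D"
  \<comment> \<open>Positivity of \<open>h\<close> is the last required inequality. At
    \<open>1 / k\<close> its value is nonnegative and, because \<open>A < c\<close>, its derivative
    is positive, so a point slightly to the right will do.\<close>
  define h where "h x = c * (p * x - (p - 1)) - (Bc * x powr q - 1)" for x
  have Bk: "Bc * (1 / k) powr q = p / D"
    using k by (simp add: Bc_def powr_divide)
  have "p / D - 1 = A * (p / k - (p - 1))"
  proof -
    have "D * (p / D - 1) = p - D" using D by (simp add: right_diff_distrib)
    also have "\<dots> = q * p - q * (k * (p - 1))" by (simp add: D_def k_def algebra_simps)
    also have "\<dots> = q * k * (p / k - (p - 1))" using k by (simp add: right_diff_distrib)
    also have "\<dots> = D * (A * (p / k - (p - 1)))" using D by (simp add: A_def)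
    finally have "D * (p / D - 1) = D * (A * (p / k - (p - 1)))" .
    then show ?thesis using D by simp
  qed
  then have h0: "0 \<le> h (1 / k)"
    using pa c mult_right_mono[of A c "p / k - (p - 1)"] unfolding h_def Bk by (simp add: A_def k_def)
  have der: "(h has_real_derivative (c * p - Bc * (q * (1 / k) powr (q - 1)))) (at (1 / k))"
    unfolding h_def using k by (auto intro!: derivative_eq_intros)
  have "Bc * (q * (1 / k) powr (q - 1)) = A * p"
    using k by (simp add: Bc_def A_def powr_divide powr_diff)
  moreover have "A * p < c * p" using c p unfolding A_def k_def by (intro mult_strict_right_mono) auto
  ultimately have "0 < c * p - Bc * (q * (1 / k) powr (q - 1))" by simp
  then obtain \<delta> where \<delta>: "0 < \<delta>" "\<And>t. 0 < t \<Longrightarrow> t < \<delta> \<Longrightarrow> h (1 / k) < h (1 / k + t)"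
    using DERIV_pos_inc_right[OF der] by blast
  define t where "t = min (\<delta> / 2) ((1 - 1 / k) / 2)"
  have t: "0 < t" "t < \<delta>" "1 / k + t < 1"
    using \<delta>(1) k by (auto simp: t_def min_def field_simps)
  have "0 < h (1 / k + t)" using h0 \<delta>(2)[OF t(1,2)] by simp
  show ?thesis
  proof (rule that[of "1 / k + t"])
    show "0 < 1 / k + t" "1 / k + t < 1" using k t by (auto simp: add_pos_pos)
    \<comment> \<open>The shift by \<open>t\<close> gives strictness even at the endpoint
      \<open>\<beta> = 1 / (p - 1)\<close>, where the factor vanishes at
      \<open>1 / k\<close>.\<close>
    have "0 < p * t" using p t by simp
    then show "0 < p * (1 / k + t) - (p - 1)" using pa by (simp add: distrib_left)
    show "p * (\<beta> + 1) powr q / D * (1 / k + t) powr q - 1 < c * (p * (1 / k + t) - (p - 1))"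
      using \<open>0 < h (1 / k + t)\<close> by (simp add: h_def Bc_def k_def)
  qed
qed

text \<open>For \<open>s\<close> tending to \<open>0\<close> the coefficient of \<open>d\<close> is
  \<open>1 - s (p b - (p - 1)) + o(s)\<close>, so the recursion contracts to a value at most \<open>c\<close>.\<close>

lemma extremal_parameters:
  fixes p q b B c :: real
  assumes p: "1 < p" "1 \<le> q" "q \<le> p" and b: "0 < b" "b < 1" "0 < p * b - (p - 1)"
    and c: "0 < c" "B * b powr q - 1 < c * (p * b - (p - 1))"
  obtains s0 \<eta> where "0 < s0" "s0 < 1" "0 < \<eta>" "\<eta> \<le> 1"
    "\<And>s d. s0 / 2 \<le> s \<Longrightarrow> s \<le> s0 \<Longrightarrow> c \<le> d \<Longrightarrow>
      s * (B * ((1 - b * s0) / (1 - s0)) powr (p - q) * b powr q - 1)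
        + d * (1 - s) * ((1 - b * s) / (1 - s)) powr p \<le> c + (1 - \<eta>) * (d - c)"
proof -
  define E where "E s = 1 - (1 - s) * ((1 - b * s) / (1 - s)) powr p" for s
  \<comment> \<open>\<open>L\<close> is taken strictly below the derivative of \<open>E\<close> at
    \<open>0\<close>: its positivity gives the contraction, and \<open>c * L\<close> dominates the
    constant term of the recursion.\<close>
  have "max 0 ((B * b powr q - 1) / c) < p * b - (p - 1)"
    using b c by (simp add: pos_divide_less_eq mult.commute)
  then obtain L where L: "0 < L" "(B * b powr q - 1) / c < L" "L < p * b - (p - 1)"
    using dense by (metis max_less_iff_conj)
  have L': "B * b powr q - 1 < c * L" using L(2) c by (simp add: pos_divide_less_eq mult.commute)
  have "(E has_real_derivative (p * b - (p - 1))) (at 0)"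
    unfolding E_def by (auto intro!: derivative_eq_intros simp: algebra_simps)
  then have "((\<lambda>s. E s / s) \<longlongrightarrow> p * b - (p - 1)) (at 0)"
    by (simp add: DERIV_def E_def)
  then have "((\<lambda>s. E s / s) \<longlongrightarrow> p * b - (p - 1)) (at_right 0)"
    by (rule filterlim_mono[OF _ order_refl]) (simp add: at_le)
  then have ev1: "eventually (\<lambda>s. L < E s / s) (at_right 0)"
    using L(3) by (rule order_tendstoD)
  \<comment> \<open>The inflation by the power of the ratio tends to \<open>1\<close>, so the strict
    inequality for \<open>L\<close> survives for small \<open>s0\<close>.\<close>
  have "((\<lambda>s. B * ((1 - b * s) / (1 - s)) powr (p - q) * b powr q - 1)
      \<longlongrightarrow> B * ((1 - b * 0) / (1 - 0)) powr (p - q) * b powr q - 1) (at_right 0)"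
    by (intro tendsto_intros) auto
  then have ev2: "eventually (\<lambda>s. B * ((1 - b * s) / (1 - s)) powr (p - q) * b powr q - 1 < c * L) (at_right 0)"
    using L' by (intro order_tendstoD(2)) auto
  obtain \<delta> where \<delta>: "0 < \<delta>" "\<And>s. 0 < s \<Longrightarrow> s < \<delta> \<Longrightarrow>
      L < E s / s \<and> B * ((1 - b * s) / (1 - s)) powr (p - q) * b powr q - 1 < c * L"
    using eventually_conj[OF ev1 ev2] unfolding eventually_at_right_field by auto
  define s0 where "s0 = min (\<delta> / 2) (1 / 2)"
  have s0: "0 < s0" "s0 < \<delta>" "s0 < 1" using \<delta>(1) by (auto simp: s0_def min_def)
  have E_ge: "s * L < E s" if "0 < s" "s \<le> s0" for s
    using \<delta>(2)[of s] that s0 by (simp add: pos_less_divide_eq mult.commute)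
  have E_le: "E s < 1" if "0 < s" "s \<le> s0" for s
  proof -
    have "b * s \<le> s" using b that by (intro mult_left_le_one_le) auto
    then have "b * s < 1" using that s0 by linarith
    then have "0 < (1 - b * s) / (1 - s)" using that s0 by simp
    then have "0 < (1 - s) * ((1 - b * s) / (1 - s)) powr p"
      using that s0 by (intro mult_pos_pos) auto
    then show ?thesis by (simp add: E_def)
  qed
  \<comment> \<open>The lower bound \<open>s * L\<close> for \<open>E s\<close> at the left end of
    the window.\<close>
  define \<eta> where "\<eta> = s0 / 2 * L"
  show ?thesis
  proof (rule that[of s0 \<eta>])
    show "0 < s0" "s0 < 1" "0 < \<eta>" using s0 L by (auto simp: \<eta>_def)
    show "\<eta> \<le> 1" using E_ge[of "s0 / 2"] E_le[of "s0 / 2"] s0 by (simp add: \<eta>_def)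
    fix s d assume s: "s0 / 2 \<le> s" "s \<le> s0" and d: "c \<le> d"
    have s_pos: "0 < s" using s s0 by simp
    let ?B = "B * ((1 - b * s0) / (1 - s0)) powr (p - q) * b powr q - 1"
    have "s * ?B \<le> s * (c * L)" using \<delta>(2)[of s0] s0 s_pos by (intro mult_left_mono) auto
    also have "\<dots> \<le> c * E s" using E_ge[OF s_pos s(2)] c by (simp add: mult.left_commute)
    finally have 1: "s * ?B \<le> c * E s" .
    have "s0 / 2 * L \<le> s * L" using s L by (intro mult_right_mono) auto
    then have "\<eta> \<le> E s" using E_ge[OF s_pos s(2)] by (simp add: \<eta>_def)
    then have "(1 - E s) * (d - c) \<le> (1 - \<eta>) * (d - c)" using d by (intro mult_right_mono) auto
    moreover have "d * (1 - s) * ((1 - b * s) / (1 - s)) powr p = d * (1 - E s)"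
      by (simp add: E_def)
    \<comment> \<open>By \<open>1\<close> the left side is at most
      \<open>c * E s + d * (1 - E s)\<close>, which equals
      \<open>c + (1 - E s) * (d - c)\<close>.\<close>
    ultimately show "s * ?B + d * (1 - s) * ((1 - b * s) / (1 - s)) powr p \<le> c + (1 - \<eta>) * (d - c)"
      using 1 by (simp add: algebra_simps)
  qed
qed

section \<open>From profiles to the failure of larger constants\<close>

context measure_tree begin

text \<open>On the whole space \<open>g\<close> and \<open>R * g\<close> enclose the maximal
  function. The left integral is thus at least \<open>N\<close> and the mixed one at most
  \<open>R powr (p - q) * S\<close>, and the strict inequality \<open>d < c\<close> makes the claim
  fail.\<close>

lemma profile_defect:
  fixes p q f B R c d :: real
  assumes p: "1 < p" "1 \<le> q" "q \<le> p" and f: "0 < f" and B: "0 \<le> B" and R: "0 \<le> R" and d: "d < c"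
    and prof: "profile p q (B * R powr (p - q)) R (space M) f d \<phi> g"
  shows "tree_good M T \<phi>" "(LINT x|M. \<phi> x) = f"
    "\<not> (enn2ereal (\<integral>\<^sup>+x. ennreal_powr (tree_maximal M T \<phi> x) p \<partial>M)
        \<le> ereal (- c * f powr p)
          + ereal B * enn2ereal (\<integral>\<^sup>+x. ennreal (\<phi> x powr q)
              * ennreal_powr (tree_maximal M T \<phi> x) (p - q) \<partial>M))"
    (is "\<not> (enn2ereal ?N \<le> _ + ereal B * enn2ereal ?Q)")
proof -
  let ?m = "tree_maximal M T \<phi>"
  note int = profile_integrable[OF prof p(2,3)]
  have nonneg: "0 \<le> \<phi> x" "0 \<le> g x" for x using profileD(3)[OF prof] by blast+
  note f_le = profileD(5)[OF prof] and lower = profileD(6)[OF prof] and upper = profileD(7)[OF prof]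
  note avg = profileD(4)[OF prof] and const = profileD(8)[OF prof] and defect = profileD(9)[OF prof]
  show good: "tree_good M T \<phi>"
  proof (rule tree_good_if_locally_constant)
    fix x assume "x \<in> space M"
    from bspec[OF const this] show "\<exists>J\<in>T. x \<in> J \<and> (\<forall>z\<in>J. \<phi> z = \<phi> x)"
      by (elim bexE conjE, intro bexI conjI)
  qed (rule int(1), rule nonneg(1))
  show "(LINT x|M. \<phi> x) = f"
    using avg int(1) by (simp add: set_integral_space prob_space)
  define N where "N = (LINT x|M. g x powr p)"
  define S where "S = (LINT x|M. \<phi> x powr q * g x powr (p - q))"
  have gm: "ennreal (g x) \<le> ?m x" if x: "x \<in> space M" for x
  proof -
    obtain J where J: "J \<in> T" "x \<in> J" "g x \<le> Av M J \<phi>" using lower x by blast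
    have "ennreal (g x) \<le> ennreal (Av M J \<phi>)" using J(3) by (rule ennreal_leI)
    also have "\<dots> \<le> ?m x" using J nonneg by (intro Av_le_tree_maximal) auto
    finally show ?thesis .
  qed
  have mg: "?m x \<le> ennreal (R * g x)" if x: "x \<in> space M" for x
  proof (rule tree_maximal_least)
    fix J assume "J \<in> T" "x \<in> J"
    then show "ennreal (Av M J \<phi>) \<le> ennreal (R * g x)"
      using upper x T_space by (intro ennreal_leI) blast
  qed (rule nonneg)
  have fin: "?m x \<noteq> \<infinity>" if "x \<in> space M" for x
    using mg[OF that] by (metis ennreal_neq_top infinity_ennreal_def top.extremum_uniqueI)
  have "ennreal N = (\<integral>\<^sup>+x. ennreal (g x powr p) \<partial>M)"
    unfolding N_def using int(2) by (intro nn_integral_eq_integral[symmetric]) auto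
  also have "\<dots> \<le> ?N"
  proof (rule nn_integral_mono)
    fix x assume x: "x \<in> space M"
    have "g x \<le> enn2real (?m x)"
      using enn2real_mono[OF gm[OF x]] fin[OF x] nonneg(2)[of x] by (simp add: less_top)
    then show "ennreal (g x powr p) \<le> ennreal_powr (?m x) p"
      using fin[OF x] nonneg(2)[of x] p by (simp add: ennreal_powr_def ennreal_leI powr_mono2)
  qed
  finally have N: "ennreal N \<le> ?N" .
  have "?Q \<le> (\<integral>\<^sup>+x. ennreal (R powr (p - q) * (\<phi> x powr q * g x powr (p - q))) \<partial>M)"
  proof (rule nn_integral_mono)
    fix x assume x: "x \<in> space M"
    have gx: "0 < g x" using f_le x f by force
    have m_le: "enn2real (?m x) \<le> R * g x"
      using enn2real_mono[OF mg[OF x]] R nonneg(2)[of x] by simp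
    \<comment> \<open>Needed for \<open>p = q\<close>: the power with exponent \<open>0\<close> is
      \<open>1\<close> only for a nonzero real base.\<close>
    have R_pos: "0 < R"
    proof (rule ccontr)
      assume "\<not> 0 < R"
      then have "?m x \<le> 0" using mg[OF x] R by simp
      moreover have "0 < ennreal (g x)" using gx by simp
      ultimately show False using gm[OF x] by (meson less_le_trans not_less)
    qed
    have "ennreal_powr (?m x) (p - q) \<le> ennreal ((R * g x) powr (p - q))"
    proof (cases "p = q")
      case True
      then show ?thesis using R_pos gx by (simp add: ennreal_powr_def)
    next
      case False
      then show ?thesis using fin[OF x] m_le p
        by (simp add: ennreal_powr_def ennreal_leI powr_mono2)
    qed
    then have "ennreal (\<phi> x powr q) * ennreal_powr (?m x) (p - q)
      \<le> ennreal (\<phi> x powr q) * ennreal ((R * g x) powr (p - q))"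
      by (intro mult_left_mono) auto
    also have "\<dots> = ennreal (R powr (p - q) * (\<phi> x powr q * g x powr (p - q)))"
      using R gx by (simp add: ennreal_mult[symmetric] powr_mult mult_ac)
    finally show "ennreal (\<phi> x powr q) * ennreal_powr (?m x) (p - q)
      \<le> ennreal (R powr (p - q) * (\<phi> x powr q * g x powr (p - q)))" .
  qed
  also have "\<dots> = ennreal (R powr (p - q) * S)"
    unfolding S_def using int(3)
    by (subst nn_integral_eq_integral) auto
  finally have Q: "?Q \<le> ennreal (R powr (p - q) * S)" .
  have S0: "0 \<le> S" unfolding S_def by (intro integral_nonneg_AE) simp
  have N0: "0 \<le> N" unfolding N_def by (intro integral_nonneg_AE) simp
  have "(LINT x:space M|M. g x powr p - B * R powr (p - q) * (\<phi> x powr q * g x powr (p - q)))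
    = (LINT x|M. g x powr p - B * R powr (p - q) * (\<phi> x powr q * g x powr (p - q)))"
    using int by (intro set_integral_space) auto
  also have "\<dots> = N - B * R powr (p - q) * S"
    using int by (simp add: N_def S_def)
  finally have "- d * f powr p \<le> N - B * R powr (p - q) * S"
    using defect by (simp add: prob_space)
  moreover have "d * f powr p < c * f powr p" using d f by simp
  ultimately have real: "- c * f powr p + B * (R powr (p - q) * S) < N"
    by (simp add: algebra_simps)
  have "ereal (- c * f powr p) + ereal B * enn2ereal ?Q
    \<le> ereal (- c * f powr p) + ereal B * enn2ereal (ennreal (R powr (p - q) * S))"
    using Q B by (intro add_mono ereal_mult_left_mono) (auto simp: less_eq_ennreal.rep_eq)
  also have "\<dots> = ereal (- c * f powr p + B * (R powr (p - q) * S))"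
    using S0 by (simp add: enn2ereal_ennreal)
  also have "\<dots> < ereal N" using real by simp
  also have "\<dots> = enn2ereal (ennreal N)" using N0 by (simp add: enn2ereal_ennreal)
  also have "\<dots> \<le> enn2ereal ?N" using N by (simp add: less_eq_ennreal.rep_eq)
  finally show "\<not> (enn2ereal ?N \<le> ereal (- c * f powr p) + ereal B * enn2ereal ?Q)"
    by (simp add: not_le)
qed

lemma maximal_Lp_sharp:
  fixes p q f \<beta> c :: real
  assumes p: "1 < p" "1 \<le> q" "q \<le> p" and f: "0 < f" and \<beta>: "0 < \<beta>" "\<beta> \<le> 1 / (p - 1)"
    and c: "q * (\<beta> + 1) / ((p - 1) * q * \<beta> + (p - q)) < c"
  shows "\<exists>\<phi>. tree_good M T \<phi> \<and> (LINT x|M. \<phi> x) = f \<and>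
    \<not> (enn2ereal (\<integral>\<^sup>+x. ennreal_powr (tree_maximal M T \<phi> x) p \<partial>M)
        \<le> ereal (- c * f powr p)
          + ereal (p * (\<beta> + 1) powr q / ((p - 1) * q * \<beta> + (p - q)))
            * enn2ereal (\<integral>\<^sup>+x. ennreal (\<phi> x powr q)
                * ennreal_powr (tree_maximal M T \<phi> x) (p - q) \<partial>M))"
proof -
  define D where "D = (p - 1) * q * \<beta> + (p - q)"
  have "0 < (p - 1) * q * \<beta>" using p \<beta> by simp
  then have D: "0 < D" using p by (simp add: D_def)
  define B where "B = p * (\<beta> + 1) powr q / D"
  have B: "0 \<le> B" using D p by (simp add: B_def)
  \<comment> \<open>The gap between \<open>c'\<close> and \<open>c\<close> absorbs the excess that
    is left after finitely many rounds.\<close>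
  obtain c' where c': "q * (\<beta> + 1) / D < c'" "c' < c" using dense c unfolding D_def by blast
  have "0 < q * (\<beta> + 1) / D" using D p \<beta> by simp
  then have c'_pos: "0 < c'" using c' by linarith
  obtain b where b: "0 < b" "b < 1" "0 < p * b - (p - 1)" "B * b powr q - 1 < c' * (p * b - (p - 1))"
    using extremal_slope[OF p \<beta>] c'(1) unfolding D_def B_def by metis
  obtain s0 \<eta> where s0: "0 < s0" "s0 < 1" and \<eta>: "0 < \<eta>" "\<eta> \<le> 1"
    and contract: "\<And>s d. s0 / 2 \<le> s \<Longrightarrow> s \<le> s0 \<Longrightarrow> c' \<le> d \<Longrightarrow>
      s * (B * ((1 - b * s0) / (1 - s0)) powr (p - q) * b powr q - 1)
        + d * (1 - s) * ((1 - b * s) / (1 - s)) powr p \<le> c' + (1 - \<eta>) * (d - c')"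
    using extremal_parameters[OF p b(1-3) c'_pos b(4)] by metis
  define R where "R = (1 - b * s0) / (1 - s0)"
  have "b * s0 \<le> s0" using b s0 by (intro mult_left_le_one_le) auto
  then have "b * s0 \<le> 1" using s0 by linarith
  then have R: "0 \<le> R" using s0 by (simp add: R_def)
  \<comment> \<open>Excess over \<open>c'\<close> of the defect
    \<open>B * R powr (p - q) - 1\<close> of a constant function, cut off at
    \<open>0\<close>.\<close>
  define e where "e = max 0 (B * R powr (p - q) - 1 - c')"
  have "(\<lambda>n. c' + (1 - \<eta>) ^ n * e) \<longlonglongrightarrow> c' + 0 * e"
    using \<eta> by (intro tendsto_intros LIMSEQ_realpow_zero) auto
  then have "eventually (\<lambda>n. c' + (1 - \<eta>) ^ n * e < c) sequentially"
    using c'(2) by (intro order_tendstoD(2)) auto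
  then obtain n where n: "c' + (1 - \<eta>) ^ n * e < c"
    by (auto simp: eventually_sequentially)
  have "\<exists>\<phi> g. profile p q (B * R powr (p - q)) R (space M) f (c' + (1 - \<eta>) ^ n * e) \<phi> g"
  proof (rule profile_iterate[OF p(2,3) _ _ s0 R_def])
    fix s d assume "s0 / 2 \<le> s" "s \<le> s0" "c' \<le> d"
    then show "s * (B * R powr (p - q) * b powr q - 1) + d * (1 - s) * ((1 - b * s) / (1 - s)) powr p
        \<le> c' + (1 - \<eta>) * (d - c')"
      unfolding R_def by (rule contract)
  qed (use b \<eta> f in \<open>auto simp: e_def space_in_T\<close>)
  then obtain \<phi> g where "profile p q (B * R powr (p - q)) R (space M) f (c' + (1 - \<eta>) ^ n * e) \<phi> g"
    by blast
  from profile_defect[OF p f B R n this] show ?thesis unfolding B_def D_def by blast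
qed

end

theorem theorem2:
  fixes M :: "'a measure" and T :: "'a set set" and p q :: real
  assumes "prob_space M" and "nonatomic M" and "is_tree M T"
    and "1 < p" and "1 \<le> q" and "q \<le> p"
  shows
    "(\<forall>(\<phi> :: 'a \<Rightarrow> real) (f :: real) (\<beta> :: real).
        tree_good M T \<phi> \<and> (LINT x|M. \<phi> x) = f \<and> 0 < \<beta> \<longrightarrow>
          enn2ereal (\<integral>\<^sup>+x. ennreal_powr (tree_maximal M T \<phi> x) p \<partial>M)
            \<le> ereal (- (q * (\<beta> + 1) / ((p - 1) * q * \<beta> + (p - q))) * f powr p)
              + ereal (p * (\<beta> + 1) powr q / ((p - 1) * q * \<beta> + (p - q)))
                * enn2ereal (\<integral>\<^sup>+x. ennreal (\<phi> x powr q)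
                                 * ennreal_powr (tree_maximal M T \<phi> x) (p - q) \<partial>M))
     \<and>
     (\<forall>(f :: real) (\<beta> :: real) (c :: real).
        0 < f \<and> 0 < \<beta> \<and> \<beta> \<le> 1 / (p - 1) \<and>
        q * (\<beta> + 1) / ((p - 1) * q * \<beta> + (p - q)) < c \<longrightarrow>
          (\<exists>\<phi> :: 'a \<Rightarrow> real.
             tree_good M T \<phi> \<and> (LINT x|M. \<phi> x) = f \<and>
             \<not> (enn2ereal (\<integral>\<^sup>+x. ennreal_powr (tree_maximal M T \<phi> x) p \<partial>M)
                  \<le> ereal (- c * f powr p)
                    + ereal (p * (\<beta> + 1) powr q / ((p - 1) * q * \<beta> + (p - q)))
                      * enn2ereal (\<integral>\<^sup>+x. ennreal (\<phi> x powr q)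
                                       * ennreal_powr (tree_maximal M T \<phi> x) (p - q) \<partial>M))))"
proof -
  obtain C where C: "measure_tree M T C"
  proof -
    from assms(3) obtain C where C: "\<forall>I\<in>T. C I \<subseteq> T \<and> countable (C I) \<and> (\<exists>J\<in>C I. \<exists>K\<in>C I. J \<noteq> K) \<and>
          disjoint (C I) \<and> I = \<Union>(C I)"
        "T = (\<Union>m. tree_level (space M) C m)"
        "(\<lambda>m. SUP I\<in>tree_level (space M) C m. emeasure M I) \<longlonglongrightarrow> 0"
      unfolding is_tree_def by blast
    show ?thesis
    proof (rule that[of C], intro measure_tree.intro measure_tree_axioms.intro)
      show "T \<subseteq> sets M" "\<And>I. I \<in> T \<Longrightarrow> 0 < emeasure M I"
        using assms(3) by (simp_all add: is_tree_def)
    qed (use C assms(1) in blast)+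
  qed
  interpret measure_tree M T C by (rule C)
  show ?thesis
  proof (intro conjI allI impI; elim conjE)
    fix \<phi> :: "'a \<Rightarrow> real" and f \<beta> :: real
    assume "tree_good M T \<phi>" and f: "(LINT x|M. \<phi> x) = f" and \<beta>: "0 < \<beta>"
    then have "integrable M \<phi>" "\<And>x. x \<in> space M \<Longrightarrow> 0 \<le> \<phi> x" by (auto simp: tree_good_def)
    from maximal_Lp_upper_ereal[OF this f assms(4-6) \<beta>]
    show "enn2ereal (\<integral>\<^sup>+x. ennreal_powr (tree_maximal M T \<phi> x) p \<partial>M)
            \<le> ereal (- (q * (\<beta> + 1) / ((p - 1) * q * \<beta> + (p - q))) * f powr p)
              + ereal (p * (\<beta> + 1) powr q / ((p - 1) * q * \<beta> + (p - q)))
                * enn2ereal (\<integral>\<^sup>+x. ennreal (\<phi> x powr q)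
                                 * ennreal_powr (tree_maximal M T \<phi> x) (p - q) \<partial>M)" .
  qed (rule maximal_Lp_sharp[OF assms(4-6)])
qed

end
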